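(* Let $\mathcal{A}$ be a unital $C^*$-algebra, $\mathcal{H}$ a separable Hilbert space, and let $\phi$ be a $C^*$-extreme point in $S_{\mathcal{H}}(\mathcal{A})$ with minimal Stinespring triple $(\pi,V,\mathcal{H}_\pi)$. If $D$ is any positive and invertible operator in $\pi(\mathcal{A})'$, then there exists an invertible operator $S\in\pi(\mathcal{A})'$ such that $D=S^*S$, $SVV^*=VV^*SVV^*$, and $V^*SV$ is invertible with inverse $V^*S^{-1}V$. In particular, the algebra $$\mathcal{M}=\{T\in\pi(\mathcal{A})' : TVV^*=VV^*TVV^*\}$$ has factorization in $\pi(\mathcal{A})'$.
   Context: Hilbert spaces are complex. $\mathcal{B}(\mathcal{H})$ is the algebra of bounded operators on $\mathcal{H}$, and $S_{\mathcal{H}}(\mathcal{A})$ is the set of all unital completely positive (UCP) maps $\mathcal{A}\to\mathcal{B}(\mathcal{H})$. A representation is a unital $*$-homomorphism into the bounded operators on a Hilbert space. The minimal Stinespring triple of a UCP map $\phi:\mathcal{A}\to\mathcal{B}(\mathcal{H})$ is a triple $(\pi,V,\mathcal{H}_\pi)$ consisting of a Hilbert space $\mathcal{H}_\pi$ (not necessarily separable), a representation $\pi:\mathcal{A}\to\mathcal{B}(\mathcal{H}_\pi)$ and an isometry $V:\mathcal{H}\to\mathcal{H}_\pi$ such that $\phi(a)=V^*\pi(a)V$ for all $a\in\mathcal{A}$ and $\mathcal{H}_\pi$ is the closed linear span of $\pi(\mathcal{A})V\mathcal{H}$; it is unique up to unitary equivalence. $\pi(\mathcal{A})'$ denotes the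 commutant of $\pi(\mathcal{A})$ in $\mathcal{B}(\mathcal{H}_\pi)$. A map $\phi\in S_{\mathcal{H}}(\mathcal{A})$ is a $C^*$-extreme point of $S_{\mathcal{H}}(\mathcal{A})$ if whenever $\phi(\cdot)=\sum_{i=1}^n T_i^*\phi_i(\cdot)T_i$ with $\phi_i\in S_{\mathcal{H}}(\mathcal{A})$ and invertible $T_i\in\mathcal{B}(\mathcal{H})$ satisfying $\sum_{i=1}^nT_i^*T_i=I_{\mathcal{H}}$, then for each $i$ there is a unitary $U_i\in\mathcal{B}(\mathcal{H})$ with $\phi_i(\cdot)=U_i^*\phi(\cdot)U_i$. A (not necessarily self-adjoint) subalgebra $\mathcal{M}$ of a $C^*$-algebra $\mathcal{B}$ has factorization in $\mathcal{B}$ if for every positive invertible $D\in\mathcal{B}$ there is an invertible $S$ with $S,S^{-1}\in\mathcal{M}$ and $D=S^*S$. *)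

theory Defs
  imports "HOL-Analysis.Analysis"
begin

section \<open>Complex Hilbert spaces and unital C*-algebras\<close>

class complex_vector = real_vector +
  fixes scaleC :: "complex \<Rightarrow> 'a \<Rightarrow> 'a"  (infixr \<open>*\<^sub>C\<close> 75)
  assumes scaleC_add_right: "c *\<^sub>C (x + y) = c *\<^sub>C x + c *\<^sub>C y"
    and scaleC_add_left: "(c + d) *\<^sub>C x = c *\<^sub>C x + d *\<^sub>C x"
    and scaleC_scaleC: "c *\<^sub>C d *\<^sub>C x = (c * d) *\<^sub>C x"
    and scaleC_one: "1 *\<^sub>C x = x"
    and scaleR_scaleC: "r *\<^sub>R x = complex_of_real r *\<^sub>C x"

global_interpretation complex_vector:
  vector_space "scaleC :: complex \<Rightarrow> 'a \<Rightarrow> 'a::complex_vector"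
  defines csubspace = complex_vector.subspace
    and cspan = complex_vector.span
  by unfold_locales (simp_all add: scaleC_add_right scaleC_add_left scaleC_scaleC scaleC_one)

abbreviation clinear :: "('a::complex_vector \<Rightarrow> 'b::complex_vector) \<Rightarrow> bool"
  where "clinear \<equiv> Vector_Spaces.linear scaleC scaleC"

text \<open>The inner product is linear in the first argument. Its real part is the real inner
  product of the underlying real space, which determines the norm and the metric.\<close>

class chilbert_space = complex_vector + real_inner + complete_space +
  fixes cinner :: "'a \<Rightarrow> 'a \<Rightarrow> complex"
  assumes cinner_commute: "cinner x y = cnj (cinner y x)"
    and cinner_add_left: "cinner (x + y) z = cinner x z + cinner y z"
    and cinner_scaleC_left: "cinner (c *\<^sub>C x) y = c * cinner x y"
    and Re_cinner: "Re (cinner x y) = inner x y"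

text \<open>The unit comes from the class \<open>monoid_mult\<close>, so that the zero algebra is not excluded.\<close>

class unital_cstar_algebra = complex_vector + real_normed_algebra + monoid_mult + banach +
  fixes star :: "'a \<Rightarrow> 'a"
  assumes mult_scaleC_left: "(c *\<^sub>C x) * y = c *\<^sub>C (x * y)"
    and mult_scaleC_right: "x * (c *\<^sub>C y) = c *\<^sub>C (x * y)"
    and norm_scaleC: "norm (c *\<^sub>C x) = cmod c * norm x"
    and star_star: "star (star x) = x"
    and star_add: "star (x + y) = star x + star y"
    and star_scaleC: "star (c *\<^sub>C x) = cnj c *\<^sub>C star x"
    and star_mult: "star (x * y) = star y * star x"
    and cstar_identity: "norm (star x * x) = (norm x)\<^sup>2"


section \<open>Bounded operators\<close>

text \<open>Bounded operators are represented by functions satisfying \<open>bounded_clinear\<close>;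
  composition is \<open>(\<circ>)\<close>, the identity is \<open>id\<close> and the inverse is \<open>inv\<close>.\<close>

definition bounded_clinear :: "('h::chilbert_space \<Rightarrow> 'k::chilbert_space) \<Rightarrow> bool"
  where "bounded_clinear T \<longleftrightarrow> bounded_linear T \<and> clinear T"

text \<open>By the Riesz representation theorem the description determines a unique function
  whenever \<open>bounded_clinear T\<close>; for other \<open>T\<close> the value is not used.\<close>

definition cadjoint :: "('h::chilbert_space \<Rightarrow> 'k::chilbert_space) \<Rightarrow> 'k \<Rightarrow> 'h"
  where "cadjoint T = (THE S. \<forall>x y. cinner (T x) y = cinner x (S y))"

definition op_invertible :: "('h::chilbert_space \<Rightarrow> 'h) \<Rightarrow> bool"
  where "op_invertible T \<longleftrightarrow> bounded_clinear T \<and>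
    (\<exists>S. bounded_clinear S \<and> S \<circ> T = id \<and> T \<circ> S = id)"

definition op_positive :: "('h::chilbert_space \<Rightarrow> 'h) \<Rightarrow> bool"
  where "op_positive T \<longleftrightarrow> bounded_clinear T \<and> (\<forall>x. cinner (T x) x \<in> \<real>\<^sub>\<ge>\<^sub>0)"

definition op_unitary :: "('h::chilbert_space \<Rightarrow> 'h) \<Rightarrow> bool"
  where "op_unitary U \<longleftrightarrow> bounded_clinear U \<and> cadjoint U \<circ> U = id \<and> U \<circ> cadjoint U = id"

definition op_isometry :: "('h::chilbert_space \<Rightarrow> 'k::chilbert_space) \<Rightarrow> bool"
  where "op_isometry V \<longleftrightarrow> bounded_clinear V \<and> (\<forall>x. norm (V x) = norm x)"

definition commutant :: "('h::chilbert_space \<Rightarrow> 'h) set \<Rightarrow> ('h \<Rightarrow> 'h) set"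
  where "commutant R = {T. bounded_clinear T \<and> (\<forall>X\<in>R. T \<circ> X = X \<circ> T)}"

definition op_subalgebra :: "('h::chilbert_space \<Rightarrow> 'h) set \<Rightarrow> bool"
  where "op_subalgebra M \<longleftrightarrow>
    (\<forall>T\<in>M. bounded_clinear T) \<and>
    (\<lambda>x. 0) \<in> M \<and>
    (\<forall>S\<in>M. \<forall>T\<in>M. (\<lambda>x. S x + T x) \<in> M) \<and>
    (\<forall>c. \<forall>T\<in>M. (\<lambda>x. c *\<^sub>C T x) \<in> M) \<and>
    (\<forall>S\<in>M. \<forall>T\<in>M. S \<circ> T \<in> M)"

definition unital_cstar_op_algebra :: "('h::chilbert_space \<Rightarrow> 'h) set \<Rightarrow> bool"
  where "unital_cstar_op_algebra B \<longleftrightarrow>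
    op_subalgebra B \<and> id \<in> B \<and>
    (\<forall>T\<in>B. cadjoint T \<in> B) \<and>
    (\<forall>T. bounded_clinear T \<longrightarrow> (\<forall>e>0. \<exists>S\<in>B. onorm (\<lambda>x. T x - S x) < e) \<longrightarrow> T \<in> B)"

text \<open>Invertibility of \<open>D\<close> in \<open>B\<close> is invertibility as an operator, because a C*-algebra of
  operators containing \<open>id\<close> is inverse closed.\<close>

definition has_factorization ::
    "('h::chilbert_space \<Rightarrow> 'h) set \<Rightarrow> ('h \<Rightarrow> 'h) set \<Rightarrow> bool"
  where "has_factorization M B \<longleftrightarrow>
    unital_cstar_op_algebra B \<and> op_subalgebra M \<and> M \<subseteq> B \<and>
    (\<forall>D\<in>B. op_positive D \<and> op_invertible D \<longrightarrow>
      (\<exists>S. op_invertible S \<and> S \<in> M \<and> inv S \<in> M \<and> D = cadjoint S \<circ> S))"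


section \<open>Unital completely positive maps\<close>

text \<open>An \<open>n \<times> n\<close> matrix is a function of two indices of which only the values at
  \<open>i, j < n\<close> matter. Positive elements of the matrix algebra over a C*-algebra are the
  elements \<open>B\<^sup>*B\<close>; a matrix of operators is positive if it is a positive operator on
  the \<open>n\<close>-fold direct sum of the Hilbert space.\<close>

definition matrix_positive :: "nat \<Rightarrow> (nat \<Rightarrow> nat \<Rightarrow> 'a::unital_cstar_algebra) \<Rightarrow> bool"
  where "matrix_positive n X \<longleftrightarrow>
    (\<exists>B. \<forall>i<n. \<forall>j<n. X i j = (\<Sum>k<n. star (B k i) * B k j))"

definition op_matrix_positive ::
    "nat \<Rightarrow> (nat \<Rightarrow> nat \<Rightarrow> 'h::chilbert_space \<Rightarrow> 'h) \<Rightarrow> bool"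
  where "op_matrix_positive n X \<longleftrightarrow>
    (\<forall>h :: nat \<Rightarrow> 'h. (\<Sum>i<n. cinner (\<Sum>j<n. X i j (h j)) (h i)) \<in> \<real>\<^sub>\<ge>\<^sub>0)"

definition completely_positive ::
    "('a::unital_cstar_algebra \<Rightarrow> 'h::chilbert_space \<Rightarrow> 'h) \<Rightarrow> bool"
  where "completely_positive \<phi> \<longleftrightarrow>
    (\<forall>n X. matrix_positive n X \<longrightarrow> op_matrix_positive n (\<lambda>i j. \<phi> (X i j)))"

definition UCP :: "('a::unital_cstar_algebra \<Rightarrow> 'h::chilbert_space \<Rightarrow> 'h) set"
  where "UCP = {\<phi>. (\<forall>a. bounded_clinear (\<phi> a)) \<and> (\<forall>h. clinear (\<lambda>a. \<phi> a h)) \<and>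
    \<phi> 1 = id \<and> completely_positive \<phi>}"

definition cstar_extreme :: "('a::unital_cstar_algebra \<Rightarrow> 'h::chilbert_space \<Rightarrow> 'h) \<Rightarrow> bool"
  where "cstar_extreme \<phi> \<longleftrightarrow> \<phi> \<in> UCP \<and>
    (\<forall>n (\<psi> :: nat \<Rightarrow> 'a \<Rightarrow> 'h \<Rightarrow> 'h) (T :: nat \<Rightarrow> 'h \<Rightarrow> 'h).
      (\<forall>i<n. \<psi> i \<in> UCP \<and> op_invertible (T i)) \<and>
      (\<lambda>h. \<Sum>i<n. (cadjoint (T i) \<circ> T i) h) = id \<and>
      (\<forall>a. \<phi> a = (\<lambda>h. \<Sum>i<n. (cadjoint (T i) \<circ> \<psi> i a \<circ> T i) h))
      \<longrightarrow> (\<forall>i<n. \<exists>U. op_unitary U \<and> (\<forall>a. \<psi> i a = cadjoint U \<circ> \<phi> a \<circ> U)))"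


section \<open>Representations and Stinespring triples\<close>

definition representation_on ::
    "('a::unital_cstar_algebra \<Rightarrow> 'k::chilbert_space \<Rightarrow> 'k) \<Rightarrow> bool"
  where "representation_on \<pi> \<longleftrightarrow>
    (\<forall>a. bounded_clinear (\<pi> a)) \<and> (\<forall>x. clinear (\<lambda>a. \<pi> a x)) \<and>
    \<pi> 1 = id \<and> (\<forall>a b. \<pi> (a * b) = \<pi> a \<circ> \<pi> b) \<and> (\<forall>a. \<pi> (star a) = cadjoint (\<pi> a))"

definition minimal_stinespring ::
    "('a::unital_cstar_algebra \<Rightarrow> 'h::chilbert_space \<Rightarrow> 'h) \<Rightarrow>
     ('a \<Rightarrow> 'k::chilbert_space \<Rightarrow> 'k) \<Rightarrow> ('h \<Rightarrow> 'k) \<Rightarrow> bool"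
  where "minimal_stinespring \<phi> \<pi> V \<longleftrightarrow>
    representation_on \<pi> \<and> op_isometry V \<and>
    (\<forall>a. \<phi> a = cadjoint V \<circ> \<pi> a \<circ> V) \<and>
    closure (cspan {\<pi> a (V h) | a h. True}) = UNIV"

end

theory Submission
  imports Defs
begin

text \<open>Let \<open>c > 0\<close> be so small that \<open>1 - cD\<close> is positive and \<open>V\<^sup>*(1 - cD)V\<close> is invertible.
  With \<open>T\<^sub>1\<close> and \<open>T\<^sub>2\<close> the square roots of \<open>V\<^sup>*cDV\<close> and \<open>V\<^sup>*(1 - cD)V\<close>, the map
  \<open>\<phi>\<close> is the C*-convex combination, with coefficients \<open>T\<^sub>1\<close> and \<open>T\<^sub>2\<close>, of
  \<open>T\<^sub>1\<^sup>-\<^sup>1V\<^sup>*cD\<pi>(\<cdot>)VT\<^sub>1\<^sup>-\<^sup>1\<close> and \<open>T\<^sub>2\<^sup>-\<^sup>1V\<^sup>*(1 - cD)\<pi>(\<cdot>)VT\<^sub>2\<^sup>-\<^sup>1\<close>.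
  By extremality the first map is unitarily equivalent to \<open>\<phi>\<close>, so
  \<open>V\<^sup>*D\<pi>(a)V = Z\<^sup>*V\<^sup>*\<pi>(a)VZ\<close> for an invertible \<open>Z\<close>. Hence
  \<open>\<pi>(a)Vh \<mapsto> \<pi>(a)VZh\<close> defines by minimality an operator \<open>S\<close> in the commutant with
  \<open>S\<^sup>*S = D\<close> and \<open>SV = VZ\<close>. The last identity yields \<open>S\<^sup>-\<^sup>1V = VZ\<^sup>-\<^sup>1\<close> and all the claims
  on \<open>V\<^sup>*SV\<close>.\<close>

subsection \<open>The inner product and adjoints\<close>

instance chilbert_space \<subseteq> banach ..

lemma cinner_scaleC_right: "cinner x (c *\<^sub>C y) = cnj c * cinner x (y::'h::chilbert_space)"
  by (metis cinner_commute cinner_scaleC_left complex_cnj_mult)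

lemma cinner_add_right: "cinner x (y + z) = cinner x y + cinner x (z::'h::chilbert_space)"
  by (metis cinner_commute cinner_add_left complex_cnj_add)

lemma cinner_self: "cinner x x = complex_of_real ((norm (x::'h::chilbert_space))\<^sup>2)"
proof -
  have "Im (cinner x x) = 0"
    using arg_cong[OF cinner_commute[of x x], of Im] by simp
  then show ?thesis
    by (simp add: complex_eq_iff Re_cinner power2_norm_eq_inner)
qed

lemma norm_scaleC_hilbert: "norm (c *\<^sub>C x) = cmod c * norm (x::'h::chilbert_space)"
proof -
  have "complex_of_real ((norm (c *\<^sub>C x))\<^sup>2) = complex_of_real ((cmod c * norm x)\<^sup>2)"
    unfolding cinner_self[symmetric] cinner_scaleC_left cinner_scaleC_right
    using complex_norm_square[of c]
    by (simp add: cinner_self power_mult_distrib mult.assoc[symmetric] mult.commute)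
  then show ?thesis
    using of_real_eq_iff power2_eq_iff_nonneg by (metis mult_nonneg_nonneg norm_ge_zero)
qed

text \<open>Together with \<open>Re_cinner\<close> this reduces complex identities to real ones: it
  is enough to use the real identity at \<open>x\<close> and at
  \<open>(- \<i>) *\<^sub>C x\<close>.\<close>

lemma Im_cinner: "Im (cinner x y) = inner ((- \<i>) *\<^sub>C x) (y::'h::chilbert_space)"
  unfolding Re_cinner[symmetric] cinner_scaleC_left by simp

text \<open>The real Cauchy-Schwarz inequality is applied to real and imaginary part separately,
  which costs the factor 2; any constant will do for \<open>bounded_bilinear_cinner\<close>.\<close>

lemma cmod_cinner_le: "cmod (cinner x y) \<le> norm x * norm (y::'h::chilbert_space) * 2"
proof -
  have "cmod (cinner x y) \<le> \<bar>inner x y\<bar> + \<bar>inner ((- \<i>) *\<^sub>C x) y\<bar>"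
    using cmod_le[of "cinner x y"] by (simp add: Re_cinner Im_cinner)
  also have "\<dots> \<le> norm x * norm y + norm ((- \<i>) *\<^sub>C x) * norm y"
    by (intro add_mono Cauchy_Schwarz_ineq2)
  finally show ?thesis
    by (simp add: norm_scaleC_hilbert)
qed

lemma bounded_bilinear_cinner:
  "bounded_bilinear (cinner :: 'h::chilbert_space \<Rightarrow> 'h \<Rightarrow> complex)"
proof
  show "\<exists>K. \<forall>a b::'h. norm (cinner a b) \<le> norm a * norm b * K"
    using cmod_cinner_le by blast
qed (simp_all add: cinner_add_left cinner_add_right scaleR_scaleC cinner_scaleC_left
      cinner_scaleC_right scaleR_conv_of_real)

interpretation cinner: bounded_bilinear "cinner :: 'h::chilbert_space \<Rightarrow> 'h \<Rightarrow> complex"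
  by (rule bounded_bilinear_cinner)

lemma cinner_ext:
  assumes "\<And>x. cinner x y = cinner x (z::'h::chilbert_space)"
  shows "y = z"
proof -
  have "cinner (y - z) (y - z) = 0"
    using assms by (simp add: cinner.diff_right)
  then show ?thesis
    by (simp add: cinner_self)
qed

lemma bounded_clinear_iff:
  "bounded_clinear T \<longleftrightarrow> (\<forall>x y. T (x + y) = T x + T y) \<and> (\<forall>c x. T (c *\<^sub>C x) = c *\<^sub>C T x)
    \<and> (\<exists>K. \<forall>x. norm (T x) \<le> norm x * K)"
proof
  assume "bounded_clinear T"
  then have b: "bounded_linear T" and c: "clinear T"
    by (auto simp: bounded_clinear_def)
  show "(\<forall>x y. T (x + y) = T x + T y) \<and> (\<forall>c x. T (c *\<^sub>C x) = c *\<^sub>C T x)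
      \<and> (\<exists>K. \<forall>x. norm (T x) \<le> norm x * K)"
    using bounded_linear.bounded[OF b] c by (auto simp: Vector_Spaces.linear_iff)
next
  assume r: "(\<forall>x y. T (x + y) = T x + T y) \<and> (\<forall>c x. T (c *\<^sub>C x) = c *\<^sub>C T x)
    \<and> (\<exists>K. \<forall>x. norm (T x) \<le> norm x * K)"
  have "bounded_linear T"
    using r by unfold_locales (auto simp: scaleR_scaleC)
  moreover have "clinear T"
    using r by unfold_locales auto
  ultimately show "bounded_clinear T"
    by (simp add: bounded_clinear_def)
qed

lemma bounded_clinearI:
  assumes "\<And>x y. T (x + y) = T x + T y"
    and "\<And>c x. T (c *\<^sub>C x) = c *\<^sub>C T x"
    and "\<And>x. norm (T x) \<le> norm x * K"
  shows "bounded_clinear T"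
  using assms unfolding bounded_clinear_iff by blast

lemma bounded_clinear_linear: "bounded_clinear T \<Longrightarrow> bounded_linear T"
  by (simp add: bounded_clinear_def)

lemma bounded_clinear_scaleC: "bounded_clinear T \<Longrightarrow> T (c *\<^sub>C x) = c *\<^sub>C T x"
  by (simp add: bounded_clinear_iff)

lemmas bounded_clinear_add = linear_simps(1)[OF bounded_clinear_linear]
lemmas bounded_clinear_diff = linear_simps(2)[OF bounded_clinear_linear]
lemmas bounded_clinear_zero = linear_simps(3)[OF bounded_clinear_linear]

lemma bounded_clinear_of_bounded_linear:
  assumes "bounded_linear T" "\<And>c x. T (c *\<^sub>C x) = c *\<^sub>C T x"
  shows "bounded_clinear T"
  using assms bounded_linear.bounded[OF assms(1)] linear_simps(1)[OF assms(1)]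
  by (auto simp: bounded_clinear_iff)

lemma bounded_clinear_id: "bounded_clinear id"
  by (rule bounded_clinearI[of _ 1]) simp_all

lemma bounded_clinear_const_0: "bounded_clinear (\<lambda>x. 0)"
  by (rule bounded_clinearI[of _ 1]) simp_all

lemma bounded_clinear_scaleC_id: "bounded_clinear (\<lambda>x::'h::chilbert_space. c *\<^sub>C x)"
  by (rule bounded_clinearI[of _ "cmod c"])
    (simp_all add: scaleC_add_right scaleC_scaleC norm_scaleC_hilbert mult.commute)

lemma bounded_clinear_comp:
  assumes "bounded_clinear S" "bounded_clinear T"
  shows "bounded_clinear (S \<circ> T)"
  using assms bounded_linear_compose[of S T]
  by (intro bounded_clinear_of_bounded_linear)
    (auto simp: bounded_clinear_linear bounded_clinear_scaleC comp_def)

lemma bounded_clinear_plus: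
  assumes "bounded_clinear S" "bounded_clinear T"
  shows "bounded_clinear (\<lambda>x. S x + T x)"
  using assms by (intro bounded_clinear_of_bounded_linear bounded_linear_add)
    (auto simp: bounded_clinear_linear bounded_clinear_scaleC scaleC_add_right)

lemma bounded_clinear_minus:
  assumes "bounded_clinear S" "bounded_clinear T"
  shows "bounded_clinear (\<lambda>x. S x - T x)"
  using assms by (intro bounded_clinear_of_bounded_linear bounded_linear_sub)
    (auto simp: bounded_clinear_linear bounded_clinear_scaleC complex_vector.scale_right_diff_distrib)

lemma bounded_clinear_cmult:
  assumes "bounded_clinear T"
  shows "bounded_clinear (\<lambda>x. c *\<^sub>C T x)"
  using bounded_clinear_comp[OF bounded_clinear_scaleC_id[of c] assms] by (simp add: comp_def)

lemma bounded_clinear_pos_bound: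
  assumes "bounded_clinear T"
  obtains K where "K > 0" "\<And>x. norm (T x) \<le> K * norm x"
  using bounded_linear.pos_bounded[OF bounded_clinear_linear[OF assms]]
  by (metis mult.commute)

section \<open>Riesz representation and existence of adjoints\<close>

text \<open>The representing vector minimizes \<open>(norm x)\<^sup>2 - 2 * f x\<close>. The
  parallelogram law makes minimizing sequences Cauchy, and vanishing of the first variation at the
  minimum is the claim.\<close>

lemma riesz_real:
  fixes f :: "'h::{real_inner,complete_space} \<Rightarrow> real"
  assumes f: "bounded_linear f"
  shows "\<exists>y. \<forall>x. f x = inner x y"
proof -
  obtain K where K: "\<And>x. norm (f x) \<le> norm x * K"
    using bounded_linear.bounded[OF f] by blast
  define J where "J x = (norm x)\<^sup>2 - 2 * f x" for x
  have lower: "- K\<^sup>2 \<le> J x" for x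
  proof -
    have "0 \<le> (norm x - K)\<^sup>2" by simp
    then show ?thesis
      using K[of x] unfolding J_def by (simp add: power2_diff algebra_simps abs_le_iff)
  qed
  have bdd: "bdd_below (range J)"
    using lower by (auto intro: bdd_belowI[of _ "- K\<^sup>2"])
  define m where "m = Inf (range J)"
  have m: "m \<le> J x" for x
    unfolding m_def by (rule cInf_lower[OF _ bdd]) simp
  have "\<exists>x. J x < m + inverse (real (Suc n))" for n
    using cInf_lessD[of "range J" "m + inverse (real (Suc n))"] by (auto simp: m_def)
  then obtain X where X: "\<And>n. J (X n) < m + inverse (real (Suc n))"
    by metis
  have mid: "(norm (x - y))\<^sup>2 \<le> 2 * (J x + J y - 2 * m)" for x y
  proof -
    \<comment> \<open>The linear terms cancel, so this is the parallelogram law; the value at the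
      midpoint is then at least \<open>m\<close>.\<close>
    have "(norm (x - y))\<^sup>2 = 2 * (J x + J y - 2 * J ((1/2) *\<^sub>R (x + y)))"
      unfolding J_def linear_simps[OF f] power2_norm_eq_inner
      by (simp add: inner_add inner_diff algebra_simps inner_commute)
    then show ?thesis
      using m[of "(1/2) *\<^sub>R (x + y)"] by simp
  qed
  have "Cauchy X"
  proof (rule metric_CauchyI)
    fix e :: real assume e: "0 < e"
    then obtain N where N: "inverse (real (Suc N)) < e\<^sup>2 / 4"
      using reals_Archimedean[of "e\<^sup>2 / 4"] by auto
    have "dist (X i) (X j) < e" if "N \<le> i" "N \<le> j" for i j
    proof -
      have "inverse (real (Suc i)) \<le> inverse (real (Suc N))"
        "inverse (real (Suc j)) \<le> inverse (real (Suc N))"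
        using that by (auto intro!: le_imp_inverse_le)
      then have "J (X i) < m + e\<^sup>2 / 4" "J (X j) < m + e\<^sup>2 / 4"
        using X[of i] X[of j] N by linarith+
      then have "(norm (X i - X j))\<^sup>2 < e\<^sup>2"
        using mid[of "X i" "X j"] by argo
      then show ?thesis
        using e by (simp add: dist_norm power2_less_imp_less)
    qed
    then show "\<exists>M. \<forall>m\<ge>M. \<forall>n\<ge>M. dist (X m) (X n) < e"
      by blast
  qed
  then obtain y where y: "X \<longlonglongrightarrow> y"
    using Cauchy_convergent convergent_def by blast
  have "(\<lambda>n. J (X n)) \<longlonglongrightarrow> J y"
    unfolding J_def using y by (intro tendsto_intros bounded_linear.tendsto[OF f])
  moreover have "(\<lambda>n. m + inverse (real (Suc n))) \<longlonglongrightarrow> m + 0"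
    by (intro tendsto_intros LIMSEQ_inverse_real_of_nat)
  ultimately have "J y \<le> m + 0"
    by (rule LIMSEQ_le) (use X in \<open>auto intro: less_imp_le\<close>)
  then have min: "J y \<le> J x" for x
    using m[of x] by simp
  have "f x = inner x y" for x
  proof -
    define d where "d = inner x y - f x"
    have key: "0 \<le> 2 * t * d + t\<^sup>2 * (norm x)\<^sup>2" for t
      using min[of "y + t *\<^sub>R x"]
      unfolding J_def d_def linear_simps[OF f] power2_norm_eq_inner
      by (simp add: inner_add algebra_simps inner_commute power2_eq_square)
    show ?thesis
    proof (cases "x = 0")
      case True then show ?thesis by (simp add: linear_simps[OF f])
    next
      case False
      \<comment> \<open>This \<open>t\<close> minimizes the quadratic in \<open>key\<close>, leaving
        a nonpositive value that vanishes only for \<open>d = 0\<close>.\<close>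
      have "0 \<le> 2 * (- d / (norm x)\<^sup>2) * d + (- d / (norm x)\<^sup>2)\<^sup>2 * (norm x)\<^sup>2"
        by (rule key)
      also have "\<dots> = - (d\<^sup>2 / (norm x)\<^sup>2)"
        using False by (simp add: field_simps power2_eq_square)
      finally have "d\<^sup>2 / (norm x)\<^sup>2 \<le> 0" by simp
      then have "d = 0" using False by (simp add: divide_le_0_iff)
      then show ?thesis by (simp add: d_def)
    qed
  qed
  then show ?thesis by blast
qed

text \<open>Evaluates the definite description in \<open>cadjoint_def\<close>; concrete adjoints are
  identified below by exhibiting an operator with the adjoint identity.\<close>

lemma cadjoint_unique:
  assumes "\<And>x y. cinner (T x) y = cinner x (S y)"
  shows "cadjoint T = S"
  unfolding cadjoint_def
proof (rule the_equality)
  show "\<forall>x y. cinner (T x) y = cinner x (S y)" using assms by blast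
  fix S' assume S': "\<forall>x y. cinner (T x) y = cinner x (S' y)"
  show "S' = S"
  proof
    fix y show "S' y = S y"
      by (rule cinner_ext) (metis S' assms)
  qed
qed

text \<open>Riesz is applied to the real part only. The same vector represents the complex
  functional, because its imaginary part at \<open>x\<close> is its real part at
  \<open>(- \<i>) *\<^sub>C x\<close>.\<close>

lemma cinner_cadjoint:
  fixes T :: "'h::chilbert_space \<Rightarrow> 'k::chilbert_space"
  assumes T: "bounded_clinear T"
  shows "cinner (T x) y = cinner x (cadjoint T y)"
proof -
  have "\<exists>z. \<forall>x. cinner (T x) y = cinner x z" for y
  proof -
    have "bounded_linear (\<lambda>x. inner (T x) y)"
      using bounded_linear_compose[OF bounded_linear_inner_left bounded_clinear_linear[OF T]] .
    then obtain z where z: "\<And>x. inner (T x) y = inner x z"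
      using riesz_real by metis
    have "cinner (T x) y = cinner x z" for x
      using z[of x] z[of "(- \<i>) *\<^sub>C x"]
      unfolding bounded_clinear_scaleC[OF T] Im_cinner[symmetric]
      by (simp add: complex_eq_iff Re_cinner)
    then show ?thesis by blast
  qed
  then obtain S where S: "\<And>x y. cinner (T x) y = cinner x (S y)"
    by metis
  then show ?thesis
    using cadjoint_unique[of T S] by simp
qed

lemma cinner_cadjoint_left:
  assumes "bounded_clinear T"
  shows "cinner (cadjoint T y) x = cinner y (T x)"
  by (metis cinner_cadjoint[OF assms] cinner_commute)

lemma bounded_clinear_cadjoint:
  assumes T: "bounded_clinear T"
  shows "bounded_clinear (cadjoint T)"
proof -
  obtain K where K: "K > 0" "\<And>x. norm (T x) \<le> K * norm x"
    using bounded_clinear_pos_bound[OF T] by blast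
  show ?thesis
  proof (rule bounded_clinearI[of _ K])
    show "cadjoint T (x + y) = cadjoint T x + cadjoint T y" for x y
      by (rule cinner_ext) (simp add: cinner_add_right flip: cinner_cadjoint[OF T])
    show "cadjoint T (c *\<^sub>C x) = c *\<^sub>C cadjoint T x" for c x
      by (rule cinner_ext) (simp add: cinner_scaleC_right flip: cinner_cadjoint[OF T])
    show "norm (cadjoint T x) \<le> norm x * K" for x
    proof -
      \<comment> \<open>Testing the adjoint identity on \<open>cadjoint T x\<close> itself bounds
        this square by \<open>K * norm (cadjoint T x) * norm x\<close>; one factor cancels.\<close>
      have "(norm (cadjoint T x))\<^sup>2 = inner (T (cadjoint T x)) x"
        using arg_cong[OF cinner_cadjoint[OF T, of "cadjoint T x" x], of Re]
        by (simp add: cinner_self Re_cinner)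
      also have "\<dots> \<le> norm (T (cadjoint T x)) * norm x"
        by (rule norm_cauchy_schwarz)
      also have "\<dots> \<le> K * norm (cadjoint T x) * norm x"
        by (intro mult_right_mono K) simp
      finally have "norm (cadjoint T x) * norm (cadjoint T x)
          \<le> norm (cadjoint T x) * (norm x * K)"
        by (simp add: power2_eq_square mult_ac)
      then show ?thesis
        using K(1) by (cases "norm (cadjoint T x) = 0")
          (simp_all add: mult_le_cancel_left)
    qed
  qed
qed

lemma cadjoint_comp:
  assumes "bounded_clinear S" "bounded_clinear T"
  shows "cadjoint (S \<circ> T) = cadjoint T \<circ> cadjoint S"
  by (rule cadjoint_unique) (simp add: cinner_cadjoint assms)

text \<open>Polarization turns preservation of norms into preservation of the real, and then of the
  complex, inner product.\<close>

lemma cadjoint_isometry: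
  assumes V: "op_isometry V"
  shows "cadjoint V \<circ> V = id"
proof -
  have b: "bounded_clinear V" and n: "\<And>x. norm (V x) = norm x"
    using V by (auto simp: op_isometry_def)
  have re: "inner (V x) (V y) = inner x y" for x y
    using n[of "x + y"] n[of x] n[of y] unfolding bounded_clinear_add[OF b]
    by (simp add: dot_norm)
  have "cinner (V x) (V y) = cinner x y" for x y
    using re[of x y] re[of "(- \<i>) *\<^sub>C x" y]
    unfolding bounded_clinear_scaleC[OF b] Im_cinner[symmetric]
    by (simp add: complex_eq_iff Re_cinner)
  then have "cadjoint V (V y) = y" for y
    by (intro cinner_ext) (simp flip: cinner_cadjoint[OF b])
  then show ?thesis by auto
qed

subsection \<open>Invertible and positive operators\<close>

lemma op_invertibleI:
  assumes "bounded_clinear T" "bounded_clinear S" "\<And>x. S (T x) = x" "\<And>x. T (S x) = x"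
  shows "op_invertible T"
  using assms unfolding op_invertible_def by (auto simp: fun_eq_iff intro!: exI[of _ S])

lemma op_invertible_inv:
  assumes "op_invertible T"
  shows "bounded_clinear T" "bounded_clinear (inv T)" "inv T (T x) = x" "T (inv T x) = x"
proof -
  obtain S where S: "bounded_clinear S" "S \<circ> T = id" "T \<circ> S = id" and T: "bounded_clinear T"
    using assms unfolding op_invertible_def by blast
  have "inv T = S"
    by (rule inv_unique_comp[OF S(3,2)])
  then show "bounded_clinear T" "bounded_clinear (inv T)" "inv T (T x) = x" "T (inv T x) = x"
    using S T by (simp_all add: pointfree_idE)
qed

lemma op_invertible_comp:
  assumes S: "op_invertible S" and T: "op_invertible T"
  shows "op_invertible (S \<circ> T)"
  by (rule op_invertibleI[of _ "inv T \<circ> inv S"])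
    (simp_all add: op_invertible_inv[OF S] op_invertible_inv[OF T] bounded_clinear_comp)

lemma op_invertible_scaleC:
  assumes T: "op_invertible T" and c: "c \<noteq> 0"
  shows "op_invertible (\<lambda>x. c *\<^sub>C T x)"
  by (rule op_invertibleI[of _ "\<lambda>x. inverse c *\<^sub>C inv T x"])
    (use c in \<open>simp_all add: op_invertible_inv[OF T] bounded_clinear_cmult scaleC_scaleC scaleC_one
      bounded_clinear_scaleC[OF op_invertible_inv(1)[OF T]]
      bounded_clinear_scaleC[OF op_invertible_inv(2)[OF T]]\<close>)

lemma op_unitary_invertible:
  assumes "op_unitary U"
  shows "op_invertible U"
  using assms bounded_clinear_cadjoint unfolding op_unitary_def op_invertible_def by blast

text \<open>On a complex space a real quadratic form forces symmetry: expand it at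
  \<open>x + y\<close>, then replace \<open>x\<close> by \<open>\<i> *\<^sub>C x\<close> to get the
  real parts.\<close>

lemma op_positive_self_adjoint:
  assumes D: "op_positive D"
  shows "cinner (D x) y = cinner x (D y)"
proof -
  have b: "bounded_clinear D" and p: "\<And>x. cinner (D x) x \<in> \<real>\<^sub>\<ge>\<^sub>0"
    using D by (auto simp: op_positive_def)
  have im: "Im (cinner (D x) x) = 0" for x
    using p[of x] by (auto elim: nonneg_Reals_cases)
  have sum0: "Im (cinner (D x) y) + Im (cinner (D y) x) = 0" for x y
    using im[of "x + y"] im[of x] im[of y] unfolding bounded_clinear_add[OF b]
    by (simp add: cinner_add_left cinner_add_right)
  have 1: "Im (cinner (D x) y) = Im (cinner x (D y))"
    using sum0[of x y] arg_cong[OF cinner_commute[of "D y" x], of Im] by simp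
  have 2: "Re (cinner (D x) y) = Re (cinner x (D y))"
    using sum0[of "\<i> *\<^sub>C x" y] arg_cong[OF cinner_commute[of "D y" x], of Re]
    by (simp add: bounded_clinear_scaleC[OF b] cinner_scaleC_left cinner_scaleC_right)
  show ?thesis
    using 1 2 by (simp add: complex_eq_iff)
qed

lemma op_positiveI:
  assumes b: "bounded_clinear D" and s: "\<And>x y. cinner (D x) y = cinner x (D y)"
    and p: "\<And>x. 0 \<le> inner (D x) x"
  shows "op_positive D"
  unfolding op_positive_def
proof (intro conjI allI)
  fix x
  have "Im (cinner (D x) x) = 0"
    using arg_cong[OF cinner_commute[of "D x" x], of Im] s[of x x] by simp
  then have "cinner (D x) x = complex_of_real (inner (D x) x)"
    by (simp add: complex_eq_iff Re_cinner)
  then show "cinner (D x) x \<in> \<real>\<^sub>\<ge>\<^sub>0"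
    using p[of x] by simp
qed (rule b)

lemma op_positive_inner: "op_positive D \<Longrightarrow> 0 \<le> inner (D x) x"
  unfolding op_positive_def by (metis Re_cinner nonneg_Reals_cases Re_complex_of_real)

text \<open>Positivity at the single vector \<open>x - t *\<^sub>R D x\<close> already gives
  \<open>t * (norm (D x))\<^sup>2 \<le> inner (D x) x\<close>, and boundedness of the inverse
  controls \<open>norm x\<close> by \<open>norm (D x)\<close>. No square root of \<open>D\<close> is
  involved.\<close>

lemma op_positive_invertible_bounded_below:
  assumes D: "op_positive D" and inv: "op_invertible D"
  obtains e where "e > 0" "\<And>x. e * (norm x)\<^sup>2 \<le> inner (D x) x"
proof -
  have b: "bounded_clinear D" using D by (simp add: op_positive_def)
  obtain M where M: "M > 0" "\<And>x. norm (D x) \<le> M * norm x"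
    using bounded_clinear_pos_bound[OF b] by blast
  obtain L where L: "L > 0" "\<And>x. norm (inv D x) \<le> L * norm x"
    using bounded_clinear_pos_bound[OF op_invertible_inv(2)[OF inv]] by blast
  have sa: "inner (D x) y = inner x (D y)" for x y
    using op_positive_self_adjoint[OF D, of x y] by (metis Re_cinner)
  have "1 / (L\<^sup>2 * M) * (norm x)\<^sup>2 \<le> inner (D x) x" for x
  proof -
    \<comment> \<open>With this value the quadratic term, at most
      \<open>t\<^sup>2 * M * (norm (D x))\<^sup>2\<close>, absorbs exactly half of the cross
      term.\<close>
    define t where "t = 1 / M"
    have tM: "t > 0" "t * M = 1" using M(1) by (simp_all add: t_def)
    have Dt: "D (x - t *\<^sub>R D x) = D x - t *\<^sub>R D (D x)"
      by (simp add: linear_simps[OF bounded_clinear_linear[OF b]])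
    have "0 \<le> inner (D (x - t *\<^sub>R D x)) (x - t *\<^sub>R D x)"
      by (rule op_positive_inner[OF D])
    also have "\<dots> = inner (D x) x - 2 * t * (norm (D x))\<^sup>2 + t\<^sup>2 * inner (D (D x)) (D x)"
      unfolding Dt power2_norm_eq_inner
      by (simp add: inner_diff algebra_simps sa[of "D x" x] power2_eq_square)
    also have "inner (D (D x)) (D x) \<le> M * (norm (D x))\<^sup>2"
      using order_trans[OF norm_cauchy_schwarz[of "D (D x)" "D x"]
          mult_right_mono[OF M(2)[of "D x"] norm_ge_zero[of "D x"]]]
      by (simp add: power2_eq_square mult.assoc)
    finally have "0 \<le> inner (D x) x - 2 * t * (norm (D x))\<^sup>2 + t\<^sup>2 * (M * (norm (D x))\<^sup>2)"
      using tM(1) by (simp add: mult_left_mono)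
    also have "t\<^sup>2 * (M * (norm (D x))\<^sup>2) = t * (norm (D x))\<^sup>2 * (t * M)"
      by (simp add: power2_eq_square)
    finally have 1: "t * (norm (D x))\<^sup>2 \<le> inner (D x) x"
      unfolding tM(2) by simp
    have "norm x \<le> L * norm (D x)"
      using L(2)[of "D x"] by (simp add: op_invertible_inv(3)[OF inv])
    then have "(norm x)\<^sup>2 \<le> L\<^sup>2 * (norm (D x))\<^sup>2"
      by (metis norm_ge_zero power_mono power_mult_distrib)
    then have "(norm x)\<^sup>2 / L\<^sup>2 \<le> (norm (D x))\<^sup>2"
      using L(1) by (simp add: field_simps)
    then have "t * ((norm x)\<^sup>2 / L\<^sup>2) \<le> t * (norm (D x))\<^sup>2"
      by (rule mult_left_mono) (use tM in simp)
    then show ?thesis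
      using 1 by (simp add: t_def mult.commute)
  qed
  then show thesis
    using that[of "1 / (L\<^sup>2 * M)"] L(1) M(1) by simp
qed

section \<open>Inverses and square roots of operators near the identity\<close>

text \<open>A fixed point argument in place of the Neumann series: \<open>T x = z\<close> says that
  \<open>x\<close> is fixed by the \<open>r\<close>-contraction sending \<open>x\<close> to
  \<open>(x - T x) + z\<close>.\<close>

lemma op_invertible_near_id:
  assumes T: "bounded_clinear T" and r: "0 \<le> r" "r < 1"
    and near: "\<And>x. norm (x - T x) \<le> r * norm x"
  shows "op_invertible T"
proof -
  have ex: "\<exists>!x. (x - T x) + z = x" for z
  proof (rule banach_fix_type[OF r], intro allI)
    fix x y
    have "(x - T x) + z - ((y - T y) + z) = (x - y) - T (x - y)"
      by (simp add: bounded_clinear_diff[OF T])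
    then show "dist ((x - T x) + z) ((y - T y) + z) \<le> r * dist x y"
      using near[of "x - y"] by (simp only: dist_norm)
  qed
  then have ex1: "\<exists>!x. T x = z" for z
    using ex[of z] by (metis add_diff_cancel_left' add.commute diff_add_cancel diff_eq_eq)
  define S where "S z = (THE x. T x = z)" for z
  have TS: "T (S z) = z" for z
    unfolding S_def by (rule theI'[OF ex1])
  have ST: "S (T x) = x" for x
    using ex1[of "T x"] TS[of "T x"] by blast
  have "bounded_clinear S"
  proof (rule bounded_clinearI[of _ "1 / (1 - r)"])
    show "S (x + y) = S x + S y" for x y
      by (metis TS ST bounded_clinear_add[OF T])
    show "S (c *\<^sub>C x) = c *\<^sub>C S x" for c x
      by (metis TS ST bounded_clinear_scaleC[OF T])
    show "norm (S x) \<le> norm x * (1 / (1 - r))" for x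
    proof -
      have "norm (S x) \<le> norm (S x - T (S x)) + norm (T (S x))"
        by (metis diff_add_cancel norm_triangle_ineq)
      then have "norm (S x) * (1 - r) \<le> norm x"
        using near[of "S x"] by (simp add: TS algebra_simps)
      then show ?thesis
        using r by (simp add: field_simps)
    qed
  qed
  then show ?thesis
    using T ST TS by (intro op_invertibleI)
qed

text \<open>With \<open>A = 1 - X\<close> and \<open>T = 1 - Y\<close>, the equation \<open>T\<^sup>2 = A\<close> is the fixed point
  equation \<open>Y = (X + Y\<^sup>2) / 2\<close>, whose right-hand side is a contraction of the ball of radius
  \<open>r\<close> around \<open>0\<close>.\<close>

lemma sqrt_near_id:
  fixes A :: "'h::chilbert_space \<Rightarrow> 'h"
  assumes A: "bounded_clinear A" and sa: "\<And>x y. cinner (A x) y = cinner x (A y)"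
    and r: "0 \<le> r" "r < 1" and near: "\<And>x. norm (x - A x) \<le> r * norm x"
  obtains T where "op_invertible T" "\<And>x y. cinner (T x) y = cinner x (T y)" "\<And>x. T (T x) = A x"
proof -
  define X where "X = Blinfun (\<lambda>x. x - A x)"
  have X: "blinfun_apply X = (\<lambda>x. x - A x)"
    unfolding X_def by (intro bounded_linear_Blinfun_apply bounded_linear_sub
        bounded_linear_ident bounded_clinear_linear A)
  have nX: "norm X \<le> r"
    by (rule norm_blinfun_bound) (use r near in \<open>auto simp: X\<close>)
  \<comment> \<open>Elements of \<open>'h \<Rightarrow>\<^sub>L 'h\<close> are only real-linear.
    Complex homogeneity and symmetry are closed conditions, so they are built into the complete set
    on which the fixed point is sought.\<close>
  define s where "s = {Y :: 'h \<Rightarrow>\<^sub>L 'h. norm Y \<le> r \<and>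
    (\<forall>c x. blinfun_apply Y (c *\<^sub>C x) = c *\<^sub>C blinfun_apply Y x) \<and>
    (\<forall>x y. cinner (blinfun_apply Y x) y = cinner x (blinfun_apply Y y))}"
  define f where "f Y = (1/2) *\<^sub>R (X + (Y o\<^sub>L Y))" for Y
  have scont: "continuous_on UNIV (\<lambda>Y :: 'h \<Rightarrow>\<^sub>L 'h. c *\<^sub>C blinfun_apply Y x)" for c x
    by (intro bounded_linear.continuous_on[OF bounded_clinear_linear[OF bounded_clinear_scaleC_id]]
        continuous_intros)
  have "closed s"
    unfolding s_def
    by (intro closed_Collect_conj closed_Collect_all closed_Collect_le closed_Collect_eq
        continuous_intros scont cinner.continuous_on)
  then have "complete s"
    by (simp add: complete_eq_closed)
  moreover have "s \<noteq> {}"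
    using r by (auto simp: s_def cinner.zero_left cinner.zero_right intro!: exI[of _ 0])
  moreover have "f ` s \<subseteq> s"
  proof safe
    fix Y assume Y: "Y \<in> s"
    have "norm (Y o\<^sub>L Y) \<le> r * r"
      using Y r by (intro order_trans[OF norm_blinfun_compose] mult_mono) (auto simp: s_def)
    also have "\<dots> \<le> r" using r by (simp add: mult_left_le)
    finally have "norm (f Y) \<le> r"
      unfolding f_def using norm_triangle_ineq[of X "Y o\<^sub>L Y"] nX by simp
    moreover have "f Y (c *\<^sub>C x) = c *\<^sub>C f Y x" for c x
      using Y unfolding f_def s_def
      by (simp add: blinfun.add_left blinfun.scaleR_left X bounded_clinear_scaleC[OF A]
          scaleC_add_right scaleR_scaleC scaleC_scaleC mult.commute
          complex_vector.scale_right_diff_distrib)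
    moreover have "cinner (f Y x) y = cinner x (f Y y)" for x y
      using Y unfolding f_def s_def
      by (simp add: blinfun.add_left blinfun.scaleR_left X cinner_add_left cinner_add_right
          cinner.diff_left cinner.diff_right cinner.scaleR_left cinner.scaleR_right sa)
    ultimately show "f Y \<in> s" by (simp add: s_def)
  qed
  moreover have "dist (f Y) (f Z) \<le> r * dist Y Z" if "Y \<in> s" "Z \<in> s" for Y Z
  proof -
    \<comment> \<open>This splitting of \<open>Y\<^sup>2 - Z\<^sup>2\<close> needs no commutativity;
      each summand has norm at most \<open>r * norm (Y - Z)\<close>.\<close>
    have "f Y - f Z = (1/2) *\<^sub>R ((Y o\<^sub>L (Y - Z)) + ((Y - Z) o\<^sub>L Z))"
      by (rule blinfun_eqI)
        (simp add: f_def blinfun.diff_left blinfun.diff_right blinfun.add_left blinfun.scaleR_left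
          scaleR_diff_right[symmetric] scaleR_add_right[symmetric])
    then have "dist (f Y) (f Z) \<le> (norm (Y o\<^sub>L (Y - Z)) + norm ((Y - Z) o\<^sub>L Z)) / 2"
      unfolding dist_norm by (simp add: norm_triangle_ineq)
    also have "\<dots> \<le> (r * norm (Y - Z) + norm (Y - Z) * r) / 2"
      using that r
      by (intro divide_right_mono add_mono order_trans[OF norm_blinfun_compose] mult_mono)
        (auto simp: s_def)
    finally show ?thesis by (simp add: dist_norm mult.commute)
  qed
  ultimately obtain Y where Y: "Y \<in> s" "f Y = Y"
    using Banach_fix[of s r f] r by blast
  define T where "T x = x - Y x" for x
  have bY: "bounded_clinear (blinfun_apply Y)"
    using Y(1) by (intro bounded_clinear_of_bounded_linear blinfun.bounded_linear_right)
      (auto simp: s_def)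
  have T: "bounded_clinear T"
    using bounded_clinear_minus[OF bounded_clinear_id bY] by (simp add: T_def[abs_def])
  have "norm (x - T x) \<le> r * norm x" for x
    using Y(1) norm_blinfun[of Y x] mult_right_mono[of "norm Y" r "norm x"]
    by (auto simp: T_def s_def)
  then have "op_invertible T"
    by (rule op_invertible_near_id[OF T r])
  moreover have "cinner (T x) y = cinner x (T y)" for x y
    using Y(1) by (simp add: T_def s_def cinner.diff_left cinner.diff_right)
  moreover have "T (T x) = A x" for x
  proof -
    have "2 *\<^sub>R Y x = 2 *\<^sub>R f Y x" using Y(2) by simp
    also have "\<dots> = x - A x + Y (Y x)"
      by (simp add: f_def blinfun.add_left blinfun.scaleR_left X)
    finally show ?thesis
      by (simp add: T_def blinfun.diff_right scaleR_2 algebra_simps)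
  qed
  ultimately show thesis by (rule that)
qed

subsection \<open>Operators defined on a dense subspace\<close>

lemma dense_range_induct:
  assumes "closure (range f) = UNIV" "closed {x. P x}" "\<And>i. P (f i)"
  shows "P x"
  using closure_minimal[of "range f" "{x. P x}"] assms by auto

lemma bounded_clinear_eq_on_dense:
  assumes "closure (range f) = UNIV" "bounded_clinear S" "bounded_clinear T" "\<And>i. S (f i) = T (f i)"
  shows "S x = T x"
  using assms(1)
proof (rule dense_range_induct)
  show "closed {x. S x = T x}"
    using assms(2,3) by (intro closed_Collect_eq)
      (auto intro: linear_continuous_on bounded_clinear_linear)
qed (rule assms(4))

text \<open>The subspace and the operator on it are given by a common index set: the operator to be
  extended maps \<open>f i\<close> to \<open>g i\<close>, which is well defined by the bound on \<open>norm (g i)\<close>.\<close>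

lemma dense_extension:
  fixes f :: "'i \<Rightarrow> 'k::chilbert_space" and g :: "'i \<Rightarrow> 'l::chilbert_space"
  assumes dense: "closure (range f) = UNIV"
    and add: "\<And>i j. \<exists>k. f k = f i + f j \<and> g k = g i + g j"
    and scale: "\<And>c i. \<exists>k. f k = c *\<^sub>C f i \<and> g k = c *\<^sub>C g i"
    and K: "\<And>i. norm (g i) \<le> K * norm (f i)"
  obtains S where "bounded_clinear S" "\<And>i. S (f i) = g i"
proof -
  \<comment> \<open>Differences are reached through indices, scaling by -1 and adding. Taking
    \<open>f i = f j\<close> shows that the value \<open>g i\<close> depends on \<open>f i\<close>
    alone.\<close>
  have diff: "norm (g i - g j) \<le> K * norm (f i - f j)" for i j
  proof -
    obtain j' where "f j' = (- 1) *\<^sub>C f j" "g j' = (- 1) *\<^sub>C g j"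
      using scale by blast
    moreover obtain k where "f k = f i + f j'" "g k = g i + g j'"
      using add by blast
    ultimately show ?thesis
      using K[of k] by (simp add: scaleC_one)
  qed
  \<comment> \<open>No sign of \<open>K\<close> is assumed; below, \<open>\<bar>K\<bar> + 1\<close>
    is used where a positive divisor is required.\<close>
  have K0: "norm (g i - g j) \<le> \<bar>K\<bar> * norm (f i - f j)" for i j
    using diff[of i j] mult_right_mono[OF abs_ge_self[of K] norm_ge_zero[of "f i - f j"]]
    by linarith
  have "\<exists>X. (\<lambda>n. f (X n)) \<longlonglongrightarrow> x" for x
  proof -
    have "x \<in> closure (range f)" using dense by simp
    then obtain u where u: "\<And>n. u n \<in> range f" "u \<longlonglongrightarrow> x"
      unfolding closure_sequential by blast
    from u(1) have "\<forall>n. \<exists>i. u n = f i" by blast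
    then obtain X where "\<forall>n. u n = f (X n)" by metis
    then have "u = (\<lambda>n. f (X n))" by (simp add: fun_eq_iff)
    with u(2) show ?thesis by blast
  qed
  then obtain X where X: "\<And>x. (\<lambda>n. f (X x n)) \<longlonglongrightarrow> x" by metis
  have "Cauchy (\<lambda>n. g (X x n))" for x
  proof (rule metric_CauchyI)
    fix e :: real assume e: "0 < e"
    have "Cauchy (\<lambda>n. f (X x n))"
      using X[of x] convergent_Cauchy convergent_def by blast
    then obtain M where M: "\<And>m n. m \<ge> M \<Longrightarrow> n \<ge> M \<Longrightarrow>
        dist (f (X x m)) (f (X x n)) < e / (\<bar>K\<bar> + 1)"
      using metric_CauchyD[of _ "e / (\<bar>K\<bar> + 1)"] e by (metis abs_add_one_gt_zero add.commute divide_pos_pos)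
    have "dist (g (X x m)) (g (X x n)) < e" if "m \<ge> M" "n \<ge> M" for m n
    proof -
      have "dist (g (X x m)) (g (X x n)) \<le> (\<bar>K\<bar> + 1) * dist (f (X x m)) (f (X x n))"
        using K0[of "X x m" "X x n"] norm_ge_zero[of "f (X x m) - f (X x n)"]
        unfolding dist_norm distrib_right by linarith
      also have "\<dots> < (\<bar>K\<bar> + 1) * (e / (\<bar>K\<bar> + 1))"
        by (intro mult_strict_left_mono M that) simp
      finally show ?thesis by simp
    qed
    then show "\<exists>M. \<forall>m\<ge>M. \<forall>n\<ge>M. dist (g (X x m)) (g (X x n)) < e" by blast
  qed
  then have "\<exists>y. (\<lambda>n. g (X x n)) \<longlonglongrightarrow> y" for x
    using Cauchy_convergent convergent_def by blast
  then obtain S where S: "\<And>x. (\<lambda>n. g (X x n)) \<longlonglongrightarrow> S x" by metis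
  \<comment> \<open>The limit does not depend on the chosen sequence, so linearity can be checked
    along sums and multiples of the sequences \<open>X x\<close>, and \<open>S (f i) = g i\<close>
    along a constant one.\<close>
  have lim: "(\<lambda>n. g (Y n)) \<longlonglongrightarrow> S x" if Y: "(\<lambda>n. f (Y n)) \<longlonglongrightarrow> x" for Y x
  proof -
    have "(\<lambda>n. \<bar>K\<bar> * norm (f (Y n) - f (X x n))) \<longlonglongrightarrow> \<bar>K\<bar> * norm (x - x)"
      by (intro tendsto_intros Y X)
    then have "(\<lambda>n. \<bar>K\<bar> * norm (f (Y n) - f (X x n))) \<longlonglongrightarrow> 0"
      by simp
    with always_eventually[OF allI[OF K0]] have "(\<lambda>n. g (Y n) - g (X x n)) \<longlonglongrightarrow> 0"
      by (rule Lim_null_comparison)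
    from tendsto_add[OF this S[of x]] show ?thesis by simp
  qed
  have "bounded_clinear S"
  proof (rule bounded_clinearI[of _ K])
    fix x y
    have "\<forall>n. \<exists>k. f k = f (X x n) + f (X y n) \<and> g k = g (X x n) + g (X y n)"
      using add by blast
    then obtain Y where Y: "\<And>n. f (Y n) = f (X x n) + f (X y n)" "\<And>n. g (Y n) = g (X x n) + g (X y n)"
      by metis
    have "(\<lambda>n. f (Y n)) \<longlonglongrightarrow> x + y"
      unfolding Y by (intro tendsto_add X)
    from lim[OF this] have "(\<lambda>n. g (X x n) + g (X y n)) \<longlonglongrightarrow> S (x + y)"
      unfolding Y .
    then show "S (x + y) = S x + S y"
      using LIMSEQ_unique tendsto_add[OF S S] by blast
  next
    fix c x
    have "\<forall>n. \<exists>k. f k = c *\<^sub>C f (X x n) \<and> g k = c *\<^sub>C g (X x n)"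
      using scale by blast
    then obtain Y where Y: "\<And>n. f (Y n) = c *\<^sub>C f (X x n)" "\<And>n. g (Y n) = c *\<^sub>C g (X x n)"
      by metis
    note cont = bounded_linear.tendsto[OF bounded_clinear_linear[OF bounded_clinear_scaleC_id]]
    have "(\<lambda>n. f (Y n)) \<longlonglongrightarrow> c *\<^sub>C x"
      unfolding Y by (intro cont X)
    from lim[OF this] have "(\<lambda>n. c *\<^sub>C g (X x n)) \<longlonglongrightarrow> S (c *\<^sub>C x)"
      unfolding Y .
    then show "S (c *\<^sub>C x) = c *\<^sub>C S x"
      using LIMSEQ_unique cont[OF S] by blast
  next
    fix x
    have "(\<lambda>n. K * norm (f (X x n))) \<longlonglongrightarrow> K * norm x"
      by (intro tendsto_intros X)
    with tendsto_norm[OF S] have "norm (S x) \<le> K * norm x"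
      by (rule LIMSEQ_le) (use K in blast)
    then show "norm (S x) \<le> norm x * K"
      by (simp add: mult.commute)
  qed
  moreover have "S (f i) = g i" for i
    using lim[of "\<lambda>_. i" "f i"] by (simp add: LIMSEQ_const_iff)
  ultimately show thesis by (rule that)
qed

subsection \<open>Compressions of representations\<close>

lemma representation_onD:
  assumes "representation_on \<pi>"
  shows "bounded_clinear (\<pi> a)" "clinear (\<lambda>a. \<pi> a x)" "\<pi> 1 x = x" "\<pi> (a * b) x = \<pi> a (\<pi> b x)"
    "cinner (\<pi> (star a) x) y = cinner x (\<pi> a y)" "cinner (\<pi> a x) y = cinner x (\<pi> (star a) y)"
proof -
  note r = assms[unfolded representation_on_def]
  show b: "bounded_clinear (\<pi> a)" for a
    using r by simp
  show "clinear (\<lambda>a. \<pi> a x)" "\<pi> 1 x = x" "\<pi> (a * b) x = \<pi> a (\<pi> b x)"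
    using r by simp_all
  show "cinner (\<pi> a x) y = cinner x (\<pi> (star a) y)" for a
    using r cinner_cadjoint[OF b] by simp
  from this[of "star a"] show "cinner (\<pi> (star a) x) y = cinner x (\<pi> a y)"
    by (simp add: star_star)
qed

lemma representation_on_sum:
  assumes "representation_on \<pi>"
  shows "\<pi> (\<Sum>i\<in>I. a i) x = (\<Sum>i\<in>I. \<pi> (a i) x)"
proof -
  interpret l: Vector_Spaces.linear scaleC scaleC "\<lambda>a. \<pi> a x"
    by (rule representation_onD(2)[OF assms])
  show ?thesis by (rule l.sum)
qed

lemma commutantD:
  assumes "D \<in> commutant (range \<pi>)"
  shows "bounded_clinear D" "D (\<pi> a x) = \<pi> a (D x)"
  using assms by (auto simp: commutant_def fun_eq_iff)

lemma nonneg_Reals_sum: "(\<And>i. i \<in> I \<Longrightarrow> f i \<in> \<real>\<^sub>\<ge>\<^sub>0) \<Longrightarrow> sum f I \<in> (\<real>\<^sub>\<ge>\<^sub>0 :: complex set)"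
  by (induction I rule: infinite_finite_induct) (auto intro: nonneg_Reals_add_I)

text \<open>As \<open>D\<close> commutes with the representation, the form of a matrix
  \<open>B\<^sup>*B\<close> becomes the sum of \<open>cinner (D (v k)) (v k)\<close>, where
  \<open>v k\<close> is the \<open>k\<close>-th row of \<open>B\<close> applied to the vectors
  \<open>W (h j)\<close>. In the application \<open>W\<close> is \<open>V\<close> followed by a
  normalization, and \<open>unit\<close> expresses that it is the right one.\<close>

lemma compression_UCP:
  fixes \<pi> :: "'a::unital_cstar_algebra \<Rightarrow> 'k::chilbert_space \<Rightarrow> 'k"
    and W :: "'h::chilbert_space \<Rightarrow> 'k"
  assumes rep: "representation_on \<pi>" and D: "D \<in> commutant (range \<pi>)" and pos: "op_positive D"
    and W: "bounded_clinear W" and unit: "\<And>h. cadjoint W (D (W h)) = h"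
  shows "(\<lambda>a h. cadjoint W (D (\<pi> a (W h)))) \<in> UCP"
  unfolding UCP_def
proof (intro CollectI conjI allI)
  note sum = representation_on_sum[OF rep] and rep = representation_onD[OF rep]
  note Wa = bounded_clinear_cadjoint[OF W]
  note lD = bounded_clinear_linear[OF commutantD(1)[OF D]]
  have Da: "bounded_clinear (cadjoint W \<circ> D)"
    by (rule bounded_clinear_comp[OF Wa commutantD(1)[OF D]])
  show "bounded_clinear (\<lambda>h. cadjoint W (D (\<pi> a (W h))))" for a
    using bounded_clinear_comp[OF Da bounded_clinear_comp[OF rep(1)[of a] W]]
    by (simp add: comp_def)
  show "clinear (\<lambda>a. cadjoint W (D (\<pi> a (W h))))" for h
    using rep(2)[of "W h"] Da unfolding bounded_clinear_iff Vector_Spaces.linear_iff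
    using complex_vector.vector_space_axioms by simp
  show "(\<lambda>h. cadjoint W (D (\<pi> 1 (W h)))) = id"
    by (simp add: rep unit fun_eq_iff)
  show "completely_positive (\<lambda>a h. cadjoint W (D (\<pi> a (W h))))"
    unfolding completely_positive_def op_matrix_positive_def
  proof (intro allI impI)
    fix n and X :: "nat \<Rightarrow> nat \<Rightarrow> 'a" and h :: "nat \<Rightarrow> 'h"
    assume "matrix_positive n X"
    then obtain B where B: "\<And>i j. i < n \<Longrightarrow> j < n \<Longrightarrow> X i j = (\<Sum>k<n. star (B k i) * B k j)"
      unfolding matrix_positive_def by blast
    define v where "v k = (\<Sum>j<n. \<pi> (B k j) (W (h j)))" for k
    have "cinner (cadjoint W (D (\<pi> (X i j) (W (h j))))) (h i)
        = (\<Sum>k<n. cinner (D (\<pi> (B k j) (W (h j)))) (\<pi> (B k i) (W (h i))))"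
      if "i < n" "j < n" for i j
    proof -
      have "cinner (cadjoint W (D (\<pi> (X i j) (W (h j))))) (h i)
          = cinner (D (\<pi> (X i j) (W (h j)))) (W (h i))"
        by (rule cinner_cadjoint_left[OF W])
      then show ?thesis
        using that
        by (simp add: B sum linear_sum[OF bounded_linear.linear[OF lD]] cinner.sum_left rep(4,5)
            star_star commutantD(2)[OF D])
    qed
    then have "(\<Sum>i<n. cinner (\<Sum>j<n. cadjoint W (D (\<pi> (X i j) (W (h j))))) (h i))
        = (\<Sum>i<n. \<Sum>j<n. \<Sum>k<n. cinner (D (\<pi> (B k j) (W (h j)))) (\<pi> (B k i) (W (h i))))"
      by (simp add: cinner.sum_left)
    also have "\<dots> = (\<Sum>k<n. \<Sum>i<n. \<Sum>j<n. cinner (D (\<pi> (B k j) (W (h j)))) (\<pi> (B k i) (W (h i))))"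
      by (subst (2) sum.swap, subst sum.swap, rule refl)
    also have "\<dots> = (\<Sum>k<n. cinner (D (v k)) (v k))"
      by (simp add: v_def linear_sum[OF bounded_linear.linear[OF lD]] cinner.sum_left
          cinner.sum_right)
    also have "\<dots> \<in> \<real>\<^sub>\<ge>\<^sub>0"
      using pos by (intro nonneg_Reals_sum) (simp add: op_positive_def)
    finally show "(\<Sum>i<n. cinner (\<Sum>j<n. cadjoint W (D (\<pi> (X i j) (W (h j))))) (h i)) \<in> \<real>\<^sub>\<ge>\<^sub>0" .
  qed
qed

text \<open>With \<open>T\<close> a square root of \<open>V\<^sup>*DV\<close>, the map \<open>\<psi>\<close> is
  \<open>T\<^sup>-\<^sup>1V\<^sup>*D\<pi>(\<cdot>)VT\<^sup>-\<^sup>1\<close>.\<close>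

lemma compression_factor:
  assumes rep: "representation_on \<pi>" and D: "D \<in> commutant (range \<pi>)" and pos: "op_positive D"
    and V: "bounded_clinear V" and r: "0 \<le> r" "r < 1"
    and near: "\<And>h. norm (h - cadjoint V (D (V h))) \<le> r * norm h"
  obtains T \<psi> where "op_invertible T" "\<psi> \<in> UCP"
    "\<And>h. cadjoint T (T h) = cadjoint V (D (V h))"
    "\<And>a h. cadjoint T (\<psi> a (T h)) = cadjoint V (D (\<pi> a (V h)))"
proof -
  define A where "A = cadjoint V \<circ> D \<circ> V"
  have A: "bounded_clinear A"
    unfolding A_def by (intro bounded_clinear_comp bounded_clinear_cadjoint V commutantD(1)[OF D])
  have "cinner (A x) y = cinner x (A y)" for x y
  proof -
    have "cinner (A x) y = cinner (D (V x)) (V y)"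
      unfolding A_def o_apply by (rule cinner_cadjoint_left[OF V])
    then show ?thesis
      by (simp add: A_def op_positive_self_adjoint[OF pos] cinner_cadjoint[OF V])
  qed
  then obtain T where T: "op_invertible T" and Tsa: "\<And>x y. cinner (T x) y = cinner x (T y)"
    and TT: "\<And>x. T (T x) = A x"
    using sqrt_near_id[OF A _ r] near by (auto simp: A_def)
  define R where "R = inv T"
  have R: "bounded_clinear R" "\<And>x. R (T x) = x" "\<And>x. T (R x) = x"
    unfolding R_def by (rule op_invertible_inv[OF T])+
  have adT: "cadjoint T = T"
    by (rule cadjoint_unique) (rule Tsa)
  have adR: "cadjoint R = R"
    by (rule cadjoint_unique) (metis R(3) Tsa)
  have VR: "bounded_clinear (V \<circ> R)"
    by (rule bounded_clinear_comp[OF V R(1)])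
  have adVR: "cadjoint (V \<circ> R) = R \<circ> cadjoint V"
    using cadjoint_comp[OF V R(1)] by (simp add: adR)
  define \<psi> where "\<psi> a h = cadjoint (V \<circ> R) (D (\<pi> a ((V \<circ> R) h)))" for a h
  have "\<psi> \<in> UCP"
    unfolding \<psi>_def[abs_def]
  proof (rule compression_UCP[OF rep D pos VR])
    fix h
    \<comment> \<open>\<open>A\<close> is the square of \<open>T\<close>, so one factor
      \<open>R\<close> on either side cancels it.\<close>
    have "R (A (R h)) = h" by (simp add: TT[symmetric] R)
    then show "cadjoint (V \<circ> R) (D ((V \<circ> R) h)) = h"
      by (simp add: adVR A_def)
  qed
  moreover have "cadjoint T (T h) = cadjoint V (D (V h))" for h
    by (simp add: adT TT A_def)
  moreover have "cadjoint T (\<psi> a (T h)) = cadjoint V (D (\<pi> a (V h)))" for a h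
    by (simp add: adT \<psi>_def adVR R)
  ultimately show thesis
    using that T by blast
qed

subsection \<open>Factorization in the commutant\<close>

text \<open>Extremality enters the argument here only. The operator \<open>Z\<close> is the unitary
  supplied by extremality composed with a square root of the compressed \<open>D1\<close>, rescaled
  to pass from \<open>D1\<close> back to \<open>D\<close>.\<close>

lemma cstar_extreme_factor:
  fixes \<phi> :: "'a::unital_cstar_algebra \<Rightarrow> 'h::chilbert_space \<Rightarrow> 'h"
    and \<pi> :: "'a \<Rightarrow> 'k::chilbert_space \<Rightarrow> 'k"
  assumes extreme: "cstar_extreme \<phi>" and st: "minimal_stinespring \<phi> \<pi> V"
    and D: "D \<in> commutant (range \<pi>)" and pos: "op_positive D" and inv: "op_invertible D"
  obtains Z where "op_invertible Z"
    "\<And>a h k. cinner (D (\<pi> a (V h))) (V k) = cinner (\<pi> a (V (Z h))) (V (Z k))"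
proof -
  have rep: "representation_on \<pi>" and iso: "op_isometry V"
    and \<phi>: "\<And>a h. \<phi> a h = cadjoint V (\<pi> a (V h))"
    using st by (auto simp: minimal_stinespring_def)
  have V: "bounded_clinear V" and nV: "\<And>h. norm (V h) = norm h"
    using iso by (auto simp: op_isometry_def)
  have VV: "cadjoint V (V h) = h" for h
    using cadjoint_isometry[OF iso] by (simp add: fun_eq_iff)
  note bD = commutantD(1)[OF D]
  note linD = linear_simps[OF bounded_clinear_linear[OF bD]]
  note linVa = linear_simps[OF bounded_clinear_linear[OF bounded_clinear_cadjoint[OF V]]]
  define A where "A h = cadjoint V (D (V h))" for h
  have A: "bounded_clinear A"
    using bounded_clinear_comp[OF bounded_clinear_cadjoint[OF V] bounded_clinear_comp[OF bD V]]
    by (simp add: A_def[abs_def] comp_def)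
  obtain e where e: "e > 0" "\<And>x. e * (norm x)\<^sup>2 \<le> inner (D x) x"
    using op_positive_invertible_bounded_below[OF pos inv] by blast
  obtain M where M: "M > 0" "\<And>x. norm (D x) \<le> M * norm x"
    using bounded_clinear_pos_bound[OF bD] by blast
  obtain K where K: "K > 0" "\<And>x. norm (A x) \<le> K * norm x"
    using bounded_clinear_pos_bound[OF A] by blast
  \<comment> \<open>The bound \<open>1 / M\<close> makes \<open>D2\<close> positive and
    \<open>1 / (2 * K)\<close> brings its compression within 1/2 of the identity. The other two
    bounds bring the compression of \<open>D1\<close> within \<open>1 - c * e / 2\<close> and keep
    that radius nonnegative.\<close>
  define c where "c = Min {1 / M, 1 / (2 * K), e / K\<^sup>2, 1 / e}"
  have c: "c > 0" "c \<le> 1 / M" "c \<le> 1 / (2 * K)" "c \<le> e / K\<^sup>2" "c \<le> 1 / e"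
    using e(1) M(1) K(1) by (auto simp: c_def)
  then have c': "c * M \<le> 1" "c * K \<le> 1 / 2" "c * K\<^sup>2 \<le> e" "c * e \<le> 1"
    using e(1) M(1) K(1) by (simp_all add: field_simps)
  define D1 where "D1 x = c *\<^sub>R D x" for x
  define D2 where "D2 x = x - D1 x" for x
  have bD1: "bounded_clinear D1"
    using bounded_clinear_cmult[OF bD, of "complex_of_real c"]
    by (simp add: D1_def[abs_def] scaleR_scaleC)
  have bD2: "bounded_clinear D2"
    using bounded_clinear_minus[OF bounded_clinear_id bD1] by (simp add: D2_def[abs_def])
  have D1: "D1 \<in> commutant (range \<pi>)"
    using bD1 by (auto simp: commutant_def fun_eq_iff D1_def commutantD(2)[OF D]
        linear_simps[OF bounded_clinear_linear[OF representation_onD(1)[OF rep]]])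
  have D2: "D2 \<in> commutant (range \<pi>)"
    using bD2 by (auto simp: commutant_def fun_eq_iff D2_def commutantD(2)[OF D1]
        linear_simps[OF bounded_clinear_linear[OF representation_onD(1)[OF rep]]])
  have sa1: "cinner (D1 x) y = cinner x (D1 y)" for x y
    by (simp add: D1_def cinner.scaleR_left cinner.scaleR_right op_positive_self_adjoint[OF pos])
  have pos1: "op_positive D1"
    by (rule op_positiveI[OF bD1 sa1]) (use c(1) in \<open>simp add: D1_def op_positive_inner[OF pos]\<close>)
  have pos2: "op_positive D2"
  proof (rule op_positiveI[OF bD2])
    show "cinner (D2 x) y = cinner x (D2 y)" for x y
      by (simp add: D2_def cinner.diff_left cinner.diff_right sa1)
    show "0 \<le> inner (D2 x) x" for x
    proof -
      have "inner (D x) x \<le> M * (norm x)\<^sup>2"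
        using order_trans[OF norm_cauchy_schwarz[of "D x" x]
            mult_right_mono[OF M(2)[of x] norm_ge_zero[of x]]]
        by (simp add: power2_eq_square mult.assoc)
      then have "c * inner (D x) x \<le> c * M * (norm x)\<^sup>2"
        using c(1) by (simp add: mult.assoc)
      also have "\<dots> \<le> 1 * (norm x)\<^sup>2"
        by (intro mult_right_mono c') simp
      finally show ?thesis
        by (simp add: D2_def D1_def inner_diff power2_norm_eq_inner)
    qed
  qed
  \<comment> \<open>Expanding the square, the cross term gains
    \<open>2 * c * e * (norm h)\<^sup>2\<close> by the lower bound on \<open>D\<close>, while
    \<open>c * K\<^sup>2 \<le> e\<close> lets the quadratic term lose at most half of it.\<close>
  have near1: "norm (h - cadjoint V (D1 (V h))) \<le> (1 - c * e / 2) * norm h" for h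
  proof (rule power2_le_imp_le)
    have "inner (A h) h = inner (D (V h)) (V h)"
      unfolding A_def by (metis Re_cinner cinner_cadjoint_left[OF V])
    then have 1: "e * (norm h)\<^sup>2 \<le> inner (A h) h"
      using e(2)[of "V h"] by (simp add: nV)
    have "(norm (A h))\<^sup>2 \<le> K\<^sup>2 * (norm h)\<^sup>2"
      using power_mono[OF K(2)[of h] norm_ge_zero, of 2] by (simp add: power_mult_distrib)
    then have "c\<^sup>2 * (norm (A h))\<^sup>2 \<le> c * (c * K\<^sup>2) * (norm h)\<^sup>2"
      using c(1) by (simp add: power2_eq_square mult.assoc mult_left_mono)
    also have "\<dots> \<le> c * e * (norm h)\<^sup>2"
      using c(1) c'(3) by (intro mult_right_mono mult_left_mono) auto
    finally have 2: "c\<^sup>2 * (norm (A h))\<^sup>2 \<le> c * e * (norm h)\<^sup>2" .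
    have "(norm (h - cadjoint V (D1 (V h))))\<^sup>2
        = (norm h)\<^sup>2 - 2 * (c * inner (A h) h) + c\<^sup>2 * (norm (A h))\<^sup>2"
      unfolding power2_norm_eq_inner
      by (simp add: D1_def linVa A_def[symmetric] inner_diff inner_commute power2_eq_square
          algebra_simps)
    also have "\<dots> \<le> (norm h)\<^sup>2 - c * e * (norm h)\<^sup>2"
      using 2 mult_left_mono[OF 1 less_imp_le[OF c(1)]] by (simp only: mult.assoc)
    \<comment> \<open>The added term completes the square.\<close>
    also have "\<dots> \<le> (norm h)\<^sup>2 - c * e * (norm h)\<^sup>2 + (c * e / 2)\<^sup>2 * (norm h)\<^sup>2"
      by simp
    also have "\<dots> = ((1 - c * e / 2) * norm h)\<^sup>2"
      by (simp add: power2_eq_square field_simps)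
    finally show "(norm (h - cadjoint V (D1 (V h))))\<^sup>2 \<le> ((1 - c * e / 2) * norm h)\<^sup>2" .
    show "0 \<le> (1 - c * e / 2) * norm h"
      using c'(4) by simp
  qed
  have near2: "norm (h - cadjoint V (D2 (V h))) \<le> 1 / 2 * norm h" for h
  proof -
    have "h - cadjoint V (D2 (V h)) = c *\<^sub>R A h"
      by (simp add: D2_def D1_def linVa VV A_def)
    then have "norm (h - cadjoint V (D2 (V h))) \<le> c * (K * norm h)"
      using K(2)[of h] c(1) by simp
    also have "\<dots> \<le> 1 / 2 * norm h"
      using mult_right_mono[OF c'(2) norm_ge_zero[of h]] by (simp add: mult.assoc)
    finally show ?thesis .
  qed
  have "0 \<le> 1 - c * e / 2" "1 - c * e / 2 < 1"
    using c(1) e(1) c'(4) by simp_all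
  from compression_factor[OF rep D1 pos1 V this near1]
  obtain T1 \<psi>1 where T1: "op_invertible T1" "\<psi>1 \<in> UCP"
    "\<And>h. cadjoint T1 (T1 h) = cadjoint V (D1 (V h))"
    "\<And>a h. cadjoint T1 (\<psi>1 a (T1 h)) = cadjoint V (D1 (\<pi> a (V h)))"
    by blast
  from compression_factor[OF rep D2 pos2 V _ _ near2]
  obtain T2 \<psi>2 where T2: "op_invertible T2" "\<psi>2 \<in> UCP"
    "\<And>h. cadjoint T2 (T2 h) = cadjoint V (D2 (V h))"
    "\<And>a h. cadjoint T2 (\<psi>2 a (T2 h)) = cadjoint V (D2 (\<pi> a (V h)))"
    by auto
  have "\<exists>U. op_unitary U \<and> (\<forall>a. \<psi>1 a = cadjoint U \<circ> \<phi> a \<circ> U)"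
  proof -
    \<comment> \<open>A convex combination of two terms: the coefficients sum to the identity
      because \<open>D1\<close> and \<open>D2\<close> do and \<open>V\<close> is an
      isometry.\<close>
    define T where "T i = (if i = 0 then T1 else T2)" for i :: nat
    define \<psi> where "\<psi> i = (if i = 0 then \<psi>1 else \<psi>2)" for i :: nat
    have "\<forall>i<2. \<psi> i \<in> UCP \<and> op_invertible (T i)"
      using T1 T2 by (simp add: T_def \<psi>_def)
    moreover have "(\<lambda>h. \<Sum>i<2. (cadjoint (T i) \<circ> T i) h) = id"
      by (simp add: fun_eq_iff numeral_2_eq_2 T_def T1 T2 D2_def linVa VV)
    moreover have "\<phi> a = (\<lambda>h. \<Sum>i<2. (cadjoint (T i) \<circ> \<psi> i a \<circ> T i) h)" for a
      by (simp add: fun_eq_iff numeral_2_eq_2 T_def \<psi>_def T1 T2 D2_def linVa VV \<phi>)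
    ultimately have "\<forall>i<2. \<exists>U. op_unitary U \<and> (\<forall>a. \<psi> i a = cadjoint U \<circ> \<phi> a \<circ> U)"
      using extreme unfolding cstar_extreme_def by blast
    then have "\<exists>U. op_unitary U \<and> (\<forall>a. \<psi> 0 a = cadjoint U \<circ> \<phi> a \<circ> U)"
      by simp
    then show ?thesis by (simp add: \<psi>_def)
  qed
  then obtain U where U: "op_unitary U" "\<And>a h. \<psi>1 a h = cadjoint U (\<phi> a (U h))"
    by auto
  define Z0 where "Z0 = U \<circ> T1"
  \<comment> \<open>Since \<open>s * cnj s\<close> is \<open>1 / c\<close>, this factor undoes the
    scaling of \<open>D\<close> to \<open>D1\<close>.\<close>
  define s where "s = complex_of_real (1 / sqrt c)"
  define Z where "Z h = s *\<^sub>C Z0 h" for h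
  have bU: "bounded_clinear U" and bT1: "bounded_clinear T1"
    using U(1) T1(1) by (auto simp: op_unitary_def op_invertible_def)
  have s: "s \<noteq> 0" "s * cnj s = complex_of_real (1 / c)"
    using c(1) by (simp_all add: s_def flip: of_real_mult)
  have "op_invertible Z0"
    unfolding Z0_def by (intro op_invertible_comp op_unitary_invertible U T1)
  then have "op_invertible Z"
    unfolding Z_def[abs_def] by (rule op_invertible_scaleC[OF _ s(1)])
  moreover have "cinner (D (\<pi> a (V h))) (V k) = cinner (\<pi> a (V (Z h))) (V (Z k))" for a h k
  proof -
    have "complex_of_real c * cinner (D (\<pi> a (V h))) (V k) = cinner (cadjoint V (D1 (\<pi> a (V h)))) k"
      by (simp add: cinner_cadjoint_left[OF V] D1_def cinner.scaleR_left scaleR_conv_of_real)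
    also have "\<dots> = cinner (\<pi> a (V (Z0 h))) (V (Z0 k))"
      unfolding T1(4)[symmetric]
      by (simp add: cinner_cadjoint_left V bU bT1 U(2) \<phi> Z0_def)
    finally have 1: "complex_of_real c * cinner (D (\<pi> a (V h))) (V k)
      = cinner (\<pi> a (V (Z0 h))) (V (Z0 k))" .
    have "cinner (\<pi> a (V (Z h))) (V (Z k)) = (s * cnj s) * cinner (\<pi> a (V (Z0 h))) (V (Z0 k))"
      by (simp add: Z_def bounded_clinear_scaleC[OF V]
          bounded_clinear_scaleC[OF representation_onD(1)[OF rep]]
          cinner_scaleC_left cinner_scaleC_right)
    then show ?thesis
      using c(1) by (simp add: s(2) flip: 1)
  qed
  ultimately show thesis by (rule that)
qed

text \<open>The relation \<open>ZD\<close> makes the map from sums of \<open>\<pi> a (V h)\<close>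
  to sums of \<open>\<pi> a (V (Z h))\<close> carry the form of \<open>D\<close> to the inner
  product. Since \<open>D\<close> is bounded and bounded below, this map and its inverse are both
  well defined and bounded on dense subspaces.\<close>

lemma intertwiner_factor:
  fixes \<pi> :: "'a::unital_cstar_algebra \<Rightarrow> 'k::chilbert_space \<Rightarrow> 'k"
    and V :: "'h::chilbert_space \<Rightarrow> 'k"
  assumes rep: "representation_on \<pi>" and V: "bounded_clinear V"
    and dense: "closure (cspan {\<pi> a (V h) | a h. True}) = UNIV"
    and D: "D \<in> commutant (range \<pi>)" and pos: "op_positive D" and inv: "op_invertible D"
    and Z: "op_invertible Z"
    and ZD: "\<And>a h k. cinner (D (\<pi> a (V h))) (V k) = cinner (\<pi> a (V (Z h))) (V (Z k))"
  obtains S where "S \<in> commutant (range \<pi>)" "op_invertible S" "D = cadjoint S \<circ> S"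
    "\<And>h. S (V h) = V (Z h)"
proof -
  note bD = commutantD(1)[OF D]
  note r = representation_onD[OF rep]
  note pi = bounded_clinear_add[OF r(1)] bounded_clinear_zero[OF r(1)] bounded_clinear_scaleC[OF r(1)]
  \<comment> \<open>Lists of pairs serve as the common index set for \<open>dense_extension\<close>:
    each names a finite sum and its intended image.\<close>
  define f where "f xs = (\<Sum>(a, h)\<leftarrow>xs. \<pi> a (V h))" for xs
  define g where "g xs = (\<Sum>(a, h)\<leftarrow>xs. \<pi> a (V (Z h)))" for xs
  define sc :: "complex \<Rightarrow> ('a \<times> 'h) list \<Rightarrow> ('a \<times> 'h) list"
    where "sc c = map (\<lambda>(a, h). (a, c *\<^sub>C h))" for c
  \<comment> \<open>Left multiplication on indices realizes \<open>\<pi> b\<close> on both sums,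
    which gives commutation with the representation.\<close>
  define lm :: "'a \<Rightarrow> ('a \<times> 'h) list \<Rightarrow> ('a \<times> 'h) list"
    where "lm b = map (\<lambda>(a, h). (b * a, h))" for b
  have append: "f (xs @ ys) = f xs + f ys" "g (xs @ ys) = g xs + g ys" for xs ys
    by (simp_all add: f_def g_def)
  have sc: "f (sc c xs) = c *\<^sub>C f xs" "g (sc c xs) = c *\<^sub>C g xs" for c xs
    by (induction xs) (auto simp: f_def g_def sc_def scaleC_add_right pi
        bounded_clinear_scaleC[OF V] bounded_clinear_scaleC[OF op_invertible_inv(1)[OF Z]])
  have lm: "f (lm b xs) = \<pi> b (f xs)" "g (lm b xs) = \<pi> b (g xs)" for b xs
    by (induction xs) (simp_all add: f_def g_def lm_def pi r(4) split_beta)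
  \<comment> \<open>Invertibility of \<open>Z\<close> makes the two ranges coincide, so that
    \<open>g\<close> also has dense range and the inverse can be extended too.\<close>
  have gf: "g xs = f (map (\<lambda>(a, h). (a, Z h)) xs)" for xs
    by (induction xs) (auto simp: f_def g_def)
  have fg: "f xs = g (map (\<lambda>(a, h). (a, inv Z h)) xs)" for xs
    by (induction xs) (auto simp: f_def g_def op_invertible_inv[OF Z])
  have "range f = range g"
    using gf fg by blast
  have "complex_vector.subspace (range f)"
    unfolding complex_vector.subspace_def
  proof (intro conjI ballI allI)
    show "0 \<in> range f" by (rule range_eqI[of _ _ "[]"]) (simp add: f_def)
    show "x + y \<in> range f" if "x \<in> range f" "y \<in> range f" for x y
      using that by (auto simp flip: append(1))
    show "c *\<^sub>C x \<in> range f" if "x \<in> range f" for c x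
      using that by (auto simp flip: sc(1))
  qed
  moreover have "\<pi> a (V h) \<in> range f" for a h
    by (rule range_eqI[of _ _ "[(a, h)]"]) (simp add: f_def)
  ultimately have "cspan {\<pi> a (V h) | a h. True} \<subseteq> range f"
    by (intro complex_vector.span_minimal) auto
  from closure_mono[OF this] have df: "closure (range f) = UNIV"
    unfolding dense by auto
  then have dg: "closure (range g) = UNIV"
    by (simp add: \<open>range f = range g\<close>)
  \<comment> \<open>Moving \<open>\<pi> b\<close> to the left as \<open>star b\<close> reduces the
    general case to \<open>ZD\<close>; here \<open>D\<close> has to commute with the
    representation.\<close>
  have gen: "cinner (\<pi> a (V (Z h))) (\<pi> b (V (Z k))) = cinner (D (\<pi> a (V h))) (\<pi> b (V k))" for a b h k
    using ZD[of "star b * a" h k] by (simp add: r(4,5) commutantD(2)[OF D])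
  have gen1: "cinner (\<pi> a (V (Z h))) (g ys) = cinner (D (\<pi> a (V h))) (f ys)" for a h ys
    by (induction ys) (auto simp: f_def g_def cinner_add_right cinner.zero_right gen)
  have gg: "cinner (g xs) (g ys) = cinner (D (f xs)) (f ys)" for xs ys
  proof (induction xs)
    case Nil
    then show ?case
      by (simp add: f_def g_def bounded_clinear_zero[OF bD] cinner.zero_left)
  next
    case (Cons p xs)
    obtain a h where p: "p = (a, h)" by fastforce
    have "f (p # xs) = \<pi> a (V h) + f xs" "g (p # xs) = \<pi> a (V (Z h)) + g xs"
      by (simp_all add: f_def g_def p)
    then show ?case
      by (simp add: bounded_clinear_add[OF bD] cinner_add_left Cons gen1)
  qed
  have ng: "(norm (g xs))\<^sup>2 = inner (D (f xs)) (f xs)" for xs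
    using arg_cong[OF gg[of xs xs], of Re] by (simp add: cinner_self Re_cinner)
  obtain M where M: "M > 0" "\<And>x. norm (D x) \<le> M * norm x"
    using bounded_clinear_pos_bound[OF bD] by blast
  obtain e where e: "e > 0" "\<And>x. e * (norm x)\<^sup>2 \<le> inner (D x) x"
    using op_positive_invertible_bounded_below[OF pos inv] by blast
  \<comment> \<open>The upper bound for \<open>D\<close> bounds the map, and in \<open>fe\<close>
    its lower bound bounds the inverse.\<close>
  have gM: "norm (g xs) \<le> sqrt M * norm (f xs)" for xs
  proof (rule power2_le_imp_le)
    have "(norm (g xs))\<^sup>2 \<le> M * norm (f xs) * norm (f xs)"
      unfolding ng using order_trans[OF norm_cauchy_schwarz[of "D (f xs)" "f xs"]
            mult_right_mono[OF M(2) norm_ge_zero]] .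
    then show "(norm (g xs))\<^sup>2 \<le> (sqrt M * norm (f xs))\<^sup>2"
      using M(1) unfolding power_mult_distrib
      by (simp add: power2_eq_square[of "norm (f xs)"] mult.assoc)
  qed (use M(1) in simp)
  have fe: "norm (f xs) \<le> (1 / sqrt e) * norm (g xs)" for xs
  proof (rule power2_le_imp_le)
    show "(norm (f xs))\<^sup>2 \<le> (1 / sqrt e * norm (g xs))\<^sup>2"
      using e(1) e(2)[of "f xs"] unfolding power_mult_distrib ng
      by (simp add: power_divide field_simps)
  qed (use e(1) in simp)
  obtain S where S: "bounded_clinear S" "\<And>xs. S (f xs) = g xs"
    using dense_extension[OF df _ _ gM] append sc by metis
  obtain R where R: "bounded_clinear R" "\<And>xs. R (g xs) = f xs"
    using dense_extension[OF dg _ _ fe] append sc by metis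
  have RS: "R (S x) = x" for x
    using bounded_clinear_eq_on_dense[OF df bounded_clinear_comp[OF R(1) S(1)] bounded_clinear_id]
    by (simp add: S R)
  have SR: "S (R x) = x" for x
    using bounded_clinear_eq_on_dense[OF dg bounded_clinear_comp[OF S(1) R(1)] bounded_clinear_id]
    by (simp add: S R)
  have comm: "S (\<pi> a x) = \<pi> a (S x)" for a x
    using bounded_clinear_eq_on_dense[OF df bounded_clinear_comp[OF S(1) r(1)[of a]]
        bounded_clinear_comp[OF r(1)[of a] S(1)]]
    by (simp add: S flip: lm)
  have "(cadjoint S \<circ> S) x = D x" for x
  proof (rule bounded_clinear_eq_on_dense[OF df _ bD])
    show "bounded_clinear (cadjoint S \<circ> S)"
      by (intro bounded_clinear_comp bounded_clinear_cadjoint S)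
    \<comment> \<open>Density is used a second time, now for the test vector, which reduces the
      identity to \<open>gg\<close>.\<close>
    show "(cadjoint S \<circ> S) (f xs) = D (f xs)" for xs
    proof (rule cinner_ext)
      fix x
      show "cinner x ((cadjoint S \<circ> S) (f xs)) = cinner x (D (f xs))"
      proof (rule dense_range_induct[OF df, where P = "\<lambda>x. cinner x ((cadjoint S \<circ> S) (f xs)) = cinner x (D (f xs))"])
        show "closed {x. cinner x ((cadjoint S \<circ> S) (f xs)) = cinner x (D (f xs))}"
          by (intro closed_Collect_eq cinner.continuous_on continuous_intros)
        show "cinner (f ys) ((cadjoint S \<circ> S) (f xs)) = cinner (f ys) (D (f xs))" for ys
          by (simp add: S gg op_positive_self_adjoint[OF pos] flip: cinner_cadjoint[OF S(1)])
      qed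
    qed
  qed
  then have "D = cadjoint S \<circ> S" by auto
  moreover have "op_invertible S"
    by (rule op_invertibleI[OF S(1) R(1) RS SR])
  moreover have "S \<in> commutant (range \<pi>)"
    using S(1) comm by (auto simp: commutant_def fun_eq_iff)
  moreover have "S (V h) = V (Z h)" for h
    \<comment> \<open>The unit of the algebra places \<open>V h\<close> itself among the generating
      sums.\<close>
    using S(2)[of "[(1, h)]"] by (simp add: f_def g_def r(3))
  ultimately show thesis using that by blast
qed

section \<open>Algebraic structure of the commutant and of its subalgebra\<close>

text \<open>Closure under adjoints comes from the range of the representation being self-adjoint,
  norm closure from continuity of the commutator with each \<open>\<pi> a\<close>.\<close>

lemma unital_cstar_op_algebra_commutant:
  fixes \<pi> :: "'a::unital_cstar_algebra \<Rightarrow> 'k::chilbert_space \<Rightarrow> 'k"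
  assumes rep: "representation_on \<pi>"
  shows "unital_cstar_op_algebra (commutant (range \<pi>))"
  unfolding unital_cstar_op_algebra_def op_subalgebra_def
proof (intro conjI ballI allI impI)
  note r = representation_onD[OF rep]
  note lin = linear_simps[OF bounded_clinear_linear[OF r(1)]]
  have I: "T \<in> commutant (range \<pi>)" if "bounded_clinear T" "\<And>a x. T (\<pi> a x) = \<pi> a (T x)" for T
    using that by (auto simp: commutant_def fun_eq_iff)
  show "bounded_clinear T" if "T \<in> commutant (range \<pi>)" for T
    by (rule commutantD(1)[OF that])
  show "(\<lambda>x. 0) \<in> commutant (range \<pi>)"
    by (rule I) (simp_all add: bounded_clinear_const_0 lin)
  show "(\<lambda>x. S x + T x) \<in> commutant (range \<pi>)"
    if S: "S \<in> commutant (range \<pi>)" and T: "T \<in> commutant (range \<pi>)" for S T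
    by (rule I) (simp_all add: bounded_clinear_plus commutantD[OF S] commutantD[OF T] lin)
  show "(\<lambda>x. c *\<^sub>C T x) \<in> commutant (range \<pi>)" if T: "T \<in> commutant (range \<pi>)" for c T
    by (rule I)
      (simp_all add: bounded_clinear_cmult commutantD[OF T] bounded_clinear_scaleC[OF r(1)])
  show "S \<circ> T \<in> commutant (range \<pi>)"
    if S: "S \<in> commutant (range \<pi>)" and T: "T \<in> commutant (range \<pi>)" for S T
    by (rule I) (simp_all add: bounded_clinear_comp commutantD[OF S] commutantD[OF T])
  show "id \<in> commutant (range \<pi>)"
    by (rule I) (simp_all add: bounded_clinear_id)
  show "cadjoint T \<in> commutant (range \<pi>)" if T: "T \<in> commutant (range \<pi>)" for T
  proof (rule I)
    note bT = commutantD(1)[OF T]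
    show "bounded_clinear (cadjoint T)"
      by (rule bounded_clinear_cadjoint[OF bT])
    show "cadjoint T (\<pi> a x) = \<pi> a (cadjoint T x)" for a x
    proof (rule cinner_ext)
      fix y
      have "cinner y (cadjoint T (\<pi> a x)) = cinner (\<pi> (star a) (T y)) x"
        by (simp add: r(5) flip: cinner_cadjoint[OF bT])
      also have "\<dots> = cinner y (\<pi> a (cadjoint T x))"
        by (simp add: cinner_cadjoint[OF bT] r(5) flip: commutantD(2)[OF T])
      finally show "cinner y (cadjoint T (\<pi> a x)) = cinner y (\<pi> a (cadjoint T x))" .
    qed
  qed
  show "T \<in> commutant (range \<pi>)"
    if T: "bounded_clinear T"
      and appr: "\<forall>e>0. \<exists>S\<in>commutant (range \<pi>). onorm (\<lambda>x. T x - S x) < e" for T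
  proof (rule I[OF T])
    fix a x
    obtain M where M: "M > 0" "\<And>x. norm (\<pi> a x) \<le> M * norm x"
      using bounded_clinear_pos_bound[OF r(1)] by blast
    \<comment> \<open>The summand 1 keeps \<open>L\<close> positive even when
      \<open>\<pi> a x\<close> and \<open>x\<close> vanish.\<close>
    define L where "L = norm (\<pi> a x) + M * norm x + 1"
    have L: "L > 0" using M(1) by (simp add: L_def add_nonneg_pos)
    have "norm (T (\<pi> a x) - \<pi> a (T x)) \<le> e" if "e > 0" for e
    proof -
      obtain S where S: "S \<in> commutant (range \<pi>)" and less: "onorm (\<lambda>x. T x - S x) < e / L"
        using appr L \<open>e > 0\<close> by (meson divide_pos_pos)
      have "bounded_linear (\<lambda>x. T x - S x)"
        by (rule bounded_clinear_linear[OF bounded_clinear_minus[OF T commutantD(1)[OF S]]])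
      then have n: "norm (T y - S y) \<le> e / L * norm y" for y
        using onorm[of "\<lambda>x. T x - S x" y] less mult_right_mono[OF less_imp_le[OF less] norm_ge_zero[of y]]
        by linarith
      \<comment> \<open>The commutator of \<open>S\<close> is zero, so that of \<open>T\<close>
        equals that of the small operator \<open>T - S\<close>.\<close>
      have "T (\<pi> a x) - \<pi> a (T x) = (T (\<pi> a x) - S (\<pi> a x)) - \<pi> a (T x - S x)"
        by (simp add: lin commutantD(2)[OF S])
      then have "norm (T (\<pi> a x) - \<pi> a (T x)) \<le> norm (T (\<pi> a x) - S (\<pi> a x)) + norm (\<pi> a (T x - S x))"
        by (simp only: norm_triangle_ineq4)
      also have "\<dots> \<le> e / L * norm (\<pi> a x) + M * (e / L * norm x)"
        using n[of "\<pi> a x"] M(2)[of "T x - S x"] mult_left_mono[OF n[of x] less_imp_le[OF M(1)]]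
        by linarith
      also have "\<dots> = e / L * (L - 1)"
        by (simp add: L_def algebra_simps add_divide_distrib)
      also have "\<dots> \<le> e"
        using L \<open>e > 0\<close> by (simp add: field_simps)
      finally show ?thesis .
    qed
    then have "norm (T (\<pi> a x) - \<pi> a (T x)) \<le> 0"
      by (rule field_le_epsilon) simp
    then show "T (\<pi> a x) = \<pi> a (T x)" by simp
  qed
qed

text \<open>For a projection \<open>P\<close> the condition says that \<open>T\<close> leaves its
  range invariant. For products, \<open>T (P x)\<close> is itself a value of \<open>P\<close>, so
  the condition on \<open>S\<close> applies to it.\<close>

lemma op_subalgebra_range_invariant:
  assumes B: "op_subalgebra B" and P: "bounded_clinear P"
  shows "op_subalgebra {T \<in> B. \<forall>x. P (T (P x)) = T (P x)}"
  using B unfolding op_subalgebra_def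
  by (auto simp: linear_simps[OF bounded_clinear_linear[OF P]] bounded_clinear_scaleC[OF P])
    (metis)

theorem corollary2p10:
  fixes \<phi> :: "'a::unital_cstar_algebra \<Rightarrow> 'h::chilbert_space \<Rightarrow> 'h"
    and \<pi> :: "'a \<Rightarrow> 'k::chilbert_space \<Rightarrow> 'k"
    and V :: "'h \<Rightarrow> 'k"
  assumes separable: "separable_space (euclidean :: 'h topology)"
    and extreme: "cstar_extreme \<phi>"
    and stinespring: "minimal_stinespring \<phi> \<pi> V"
  shows "(\<forall>D\<in>commutant (range \<pi>). op_positive D \<and> op_invertible D \<longrightarrow>
      (\<exists>S\<in>commutant (range \<pi>). op_invertible S \<and>
        D = cadjoint S \<circ> S \<and>
        S \<circ> V \<circ> cadjoint V = V \<circ> cadjoint V \<circ> S \<circ> V \<circ> cadjoint V \<and>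
        op_invertible (cadjoint V \<circ> S \<circ> V) \<and>
        inv (cadjoint V \<circ> S \<circ> V) = cadjoint V \<circ> inv S \<circ> V))
    \<and> has_factorization
        {T \<in> commutant (range \<pi>).
          T \<circ> V \<circ> cadjoint V = V \<circ> cadjoint V \<circ> T \<circ> V \<circ> cadjoint V}
        (commutant (range \<pi>))"
    (is "?factor \<and> has_factorization ?M ?C")
proof -
  have rep: "representation_on \<pi>" and iso: "op_isometry V"
    and dense: "closure (cspan {\<pi> a (V h) | a h. True}) = UNIV"
    using stinespring by (auto simp: minimal_stinespring_def)
  have V: "bounded_clinear V"
    using iso by (simp add: op_isometry_def)
  have VV: "cadjoint V (V h) = h" for h
    using cadjoint_isometry[OF iso] by (simp add: fun_eq_iff)
  \<comment> \<open>One statement serves both conclusions: \<open>S \<in> ?M\<close> is the required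
    invariance, and \<open>inv S \<in> ?M\<close> is added for the factorization.\<close>
  have factor: "\<exists>S\<in>?C. op_invertible S \<and> D = cadjoint S \<circ> S \<and> inv S \<in> ?M \<and> S \<in> ?M \<and>
      op_invertible (cadjoint V \<circ> S \<circ> V) \<and>
      inv (cadjoint V \<circ> S \<circ> V) = cadjoint V \<circ> inv S \<circ> V"
    if D: "D \<in> ?C" "op_positive D" "op_invertible D" for D
  proof -
    obtain Z where Z: "op_invertible Z"
      and ZD: "\<And>a h k. cinner (D (\<pi> a (V h))) (V k) = cinner (\<pi> a (V (Z h))) (V (Z k))"
      using cstar_extreme_factor[OF extreme stinespring D] by metis
    obtain S where S: "S \<in> ?C" "op_invertible S" "D = cadjoint S \<circ> S" "\<And>h. S (V h) = V (Z h)"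
      using intertwiner_factor[OF rep V dense D Z ZD] by metis
    note Zi = op_invertible_inv[OF Z] and Si = op_invertible_inv[OF S(2)]
    \<comment> \<open>Invariance alone would not pass to the inverse. It does here because
      \<open>S\<close> restricted to the range of \<open>V\<close> is the invertible
      \<open>Z\<close>.\<close>
    have iS: "inv S (V h) = V (inv Z h)" for h
      using Si(3)[of "V (inv Z h)"] by (simp add: S(4) Zi)
    have "inv S (\<pi> a x) = \<pi> a (inv S x)" for a x
      using Si(3)[of "\<pi> a (inv S x)"] by (simp add: commutantD(2)[OF S(1)] Si(4))
    then have "inv S \<in> ?C"
      using Si(2) by (auto simp: commutant_def fun_eq_iff)
    then have "inv S \<in> ?M" "S \<in> ?M"
      using S(1) by (simp_all add: fun_eq_iff iS S(4) VV)
    \<comment> \<open>The two compressions are exactly \<open>Z\<close> and \<open>inv Z\<close>,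
      hence inverse to each other.\<close>
    moreover have "cadjoint V \<circ> S \<circ> V = Z" "cadjoint V \<circ> inv S \<circ> V = inv Z"
      by (simp_all add: fun_eq_iff S(4) iS VV)
    ultimately show ?thesis
      using S Z by auto
  qed
  have ?factor
    using factor by blast
  moreover have "has_factorization ?M ?C"
    unfolding has_factorization_def
  proof (intro conjI ballI impI)
    show C: "unital_cstar_op_algebra ?C"
      by (rule unital_cstar_op_algebra_commutant[OF rep])
    have "?M = {T \<in> ?C. \<forall>x. (V \<circ> cadjoint V) (T ((V \<circ> cadjoint V) x)) = T ((V \<circ> cadjoint V) x)}"
      by (auto simp: fun_eq_iff)
    then show "op_subalgebra ?M"
      using op_subalgebra_range_invariant[OF _ bounded_clinear_comp[OF V bounded_clinear_cadjoint[OF V]]]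
        C unfolding unital_cstar_op_algebra_def by simp
    show "?M \<subseteq> ?C" by blast
    show "\<exists>S. op_invertible S \<and> S \<in> ?M \<and> inv S \<in> ?M \<and> D = cadjoint S \<circ> S"
      if "D \<in> ?C" "op_positive D \<and> op_invertible D" for D
      using factor that by blast
  qed
  ultimately show ?thesis ..
qed

end
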